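(* Let $r \geq 1$ be a fixed integer. For every $k \in \mathbb{N}$, the problem \textsc{Max-Weight List $r$-Colorable Induced Subgraph} can be solved in polynomial time on $kP_3$-free graphs.
   Context: All graphs are finite and simple. $P_s$ denotes the chordless path on $s$ vertices; for a graph $G$, $kG$ denotes the disjoint union of $k$ copies of $G$. A graph is $H$-free if it contains no induced subgraph isomorphic to $H$. A coloring of $G$ is a map $\phi: V(G)\to\{1,2,\dots\}$ with $\phi(u)\neq\phi(v)$ for adjacent $u,v$. An $r$-list assignment of $G$ is a function $L: V(G)\to 2^{\{1,\dots,r\}}$; a coloring $\phi$ respects $L$ if $\phi(u)\in L(u)$ for all $u$. \textsc{Max-Weight List $r$-Colorable Induced Subgraph} ($r$ fixed): given a graph $G$, a weight function $w: V(G)\to\mathbb{Q}_+$ and an $r$-list assignment $L$ of $G$, find $F\subseteq V(G)$ such that $G[F]$ admits a coloring respecting $L$ (restricted to $F$) and $w(F)=\sum_{v\in F} w(v)$ is maximum subject to this. *)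

theory Defs
  imports Complex_Main "HOL-Computational_Algebra.Polynomial"
begin

section \<open>Finite simple graphs\<close>

record 'a graph =
  verts :: "'a set"
  edges :: "'a set set"

definition simple_graph :: "'a graph \<Rightarrow> bool" where
  "simple_graph G \<longleftrightarrow> finite (verts G) \<and> edges G \<subseteq> {e. e \<subseteq> verts G \<and> card e = 2}"

definition induced :: "'a graph \<Rightarrow> 'a set \<Rightarrow> 'a graph" where
  "induced G S = \<lparr>verts = verts G \<inter> S, edges = {e \<in> edges G. e \<subseteq> S}\<rparr>"

definition graph_iso :: "'a graph \<Rightarrow> 'b graph \<Rightarrow> bool" where
  "graph_iso G H \<longleftrightarrow>
     (\<exists>f. bij_betw f (verts G) (verts H) \<and>
          (\<forall>u\<in>verts G. \<forall>v\<in>verts G. {u, v} \<in> edges G \<longleftrightarrow> {f u, f v} \<in> edges H))"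

definition graph_free :: "'b graph \<Rightarrow> 'a graph \<Rightarrow> bool" where
  "graph_free H G \<longleftrightarrow> \<not> (\<exists>S\<subseteq>verts G. graph_iso (induced G S) H)"

definition path_graph :: "nat \<Rightarrow> nat graph" where
  "path_graph s = \<lparr>verts = {..<s}, edges = {{i, Suc i} |i. Suc i < s}\<rparr>"

definition copies :: "nat \<Rightarrow> 'a graph \<Rightarrow> (nat \<times> 'a) graph" where
  "copies k G = \<lparr>verts = {..<k} \<times> verts G, edges = {Pair i ` e |i e. i < k \<and> e \<in> edges G}\<rparr>"

definition coloring :: "'a graph \<Rightarrow> ('a \<Rightarrow> nat) \<Rightarrow> bool" where
  "coloring G \<phi> \<longleftrightarrow> (\<forall>v\<in>verts G. 1 \<le> \<phi> v) \<and> (\<forall>u v. {u, v} \<in> edges G \<longrightarrow> \<phi> u \<noteq> \<phi> v)"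

definition list_assignment :: "nat \<Rightarrow> 'a graph \<Rightarrow> ('a \<Rightarrow> nat set) \<Rightarrow> bool" where
  "list_assignment r G L \<longleftrightarrow> (\<forall>v\<in>verts G. L v \<subseteq> {1..r})"

definition respects_lists :: "'a graph \<Rightarrow> ('a \<Rightarrow> nat set) \<Rightarrow> ('a \<Rightarrow> nat) \<Rightarrow> bool" where
  "respects_lists G L \<phi> \<longleftrightarrow> (\<forall>v\<in>verts G. \<phi> v \<in> L v)"


section \<open>Max-Weight List \<open>r\<close>-Colorable Induced Subgraph\<close>

text \<open>Inputs name their vertices by natural numbers; the vertex set is an arbitrary finite
  set of them. The values of weight and list function off the vertex set are irrelevant.\<close>

record mwlcis =
  inst_graph :: "nat graph"
  inst_weight :: "nat \<Rightarrow> rat"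
  inst_lists :: "nat \<Rightarrow> nat set"

definition mwlcis_instance :: "nat \<Rightarrow> mwlcis \<Rightarrow> bool" where
  "mwlcis_instance r I \<longleftrightarrow>
     simple_graph (inst_graph I) \<and>
     (\<forall>v\<in>verts (inst_graph I). 0 \<le> inst_weight I v) \<and>
     list_assignment r (inst_graph I) (inst_lists I)"

definition mwlcis_feasible :: "mwlcis \<Rightarrow> nat set \<Rightarrow> bool" where
  "mwlcis_feasible I F \<longleftrightarrow>
     F \<subseteq> verts (inst_graph I) \<and>
     (\<exists>\<phi>. coloring (induced (inst_graph I) F) \<phi> \<and>
          respects_lists (induced (inst_graph I) F) (inst_lists I) \<phi>)"

definition mwlcis_solution :: "mwlcis \<Rightarrow> nat set \<Rightarrow> bool" where
  "mwlcis_solution I F \<longleftrightarrow>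
     mwlcis_feasible I F \<and>
     (\<forall>F'. mwlcis_feasible I F' \<longrightarrow> sum (inst_weight I) F' \<le> sum (inst_weight I) F)"


section \<open>Polynomial time\<close>

text \<open>
  The machine model is a first-order, call-by-value LISP on binary trees, in the style of the
  languages of N. D. Jones, Computability and Complexity from a Programming Perspective. The
  running time is the number of rule applications in the evaluation. Every rule costs a
  constant number of pointer operations in an implementation that shares subtrees, and \<open>t\<close>
  steps allocate at most \<open>t\<close> new tree nodes, so the model and Turing machines simulate
  each other with polynomial overhead (for outputs of polynomial size). There is no
  arithmetic: numbers have to be represented and manipulated as trees.
\<close>

datatype data = Leaf | Node data data

datatype exp =
    EVar nat
  | ELeaf
  | ENode exp exp
  | EFst exp
  | ESnd exp
  | EIf exp exp exp
  | ELet exp exp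
  | ECall nat "exp list"

text \<open>A program is the list of its function bodies. \<open>EVar i\<close> is the \<open>i\<close>-th entry of the
  environment, which holds the arguments of the current call, preceded by the values bound by
  enclosing \<open>ELet\<close>s, innermost first. Out-of-range variables and functions have no value.\<close>

type_synonym program = "exp list"

fun fst_data :: "data \<Rightarrow> data" where
  "fst_data Leaf = Leaf"
| "fst_data (Node x y) = x"

fun snd_data :: "data \<Rightarrow> data" where
  "snd_data Leaf = Leaf"
| "snd_data (Node x y) = y"

inductive
  eval :: "program \<Rightarrow> data list \<Rightarrow> exp \<Rightarrow> data \<Rightarrow> nat \<Rightarrow> bool" and
  evals :: "program \<Rightarrow> data list \<Rightarrow> exp list \<Rightarrow> data list \<Rightarrow> nat \<Rightarrow> bool"
  for P :: program
where
  eval_Var: "i < length env \<Longrightarrow> eval P env (EVar i) (env ! i) 1"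
| eval_Leaf: "eval P env ELeaf Leaf 1"
| eval_Node: "eval P env e1 x s \<Longrightarrow> eval P env e2 y t \<Longrightarrow>
    eval P env (ENode e1 e2) (Node x y) (s + t + 1)"
| eval_Fst: "eval P env e x t \<Longrightarrow> eval P env (EFst e) (fst_data x) (t + 1)"
| eval_Snd: "eval P env e x t \<Longrightarrow> eval P env (ESnd e) (snd_data x) (t + 1)"
| eval_If_Node: "eval P env b x s \<Longrightarrow> x \<noteq> Leaf \<Longrightarrow> eval P env e1 y t \<Longrightarrow>
    eval P env (EIf b e1 e2) y (s + t + 1)"
| eval_If_Leaf: "eval P env b Leaf s \<Longrightarrow> eval P env e2 y t \<Longrightarrow>
    eval P env (EIf b e1 e2) y (s + t + 1)"
| eval_Let: "eval P env e1 x s \<Longrightarrow> eval P (x # env) e2 y t \<Longrightarrow>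
    eval P env (ELet e1 e2) y (s + t + 1)"
| eval_Call: "f < length P \<Longrightarrow> evals P env es xs s \<Longrightarrow> eval P xs (P ! f) y t \<Longrightarrow>
    eval P env (ECall f es) y (s + t + 1)"
| evals_Nil: "evals P env [] [] 1"
| evals_Cons: "eval P env e x s \<Longrightarrow> evals P env es xs t \<Longrightarrow>
    evals P env (e # es) (x # xs) (s + t + 1)"

lemma eval_deterministic:
  "eval P env e x s \<Longrightarrow> eval P env e y t \<Longrightarrow> y = x \<and> t = s"
  "evals P env es xs s \<Longrightarrow> evals P env es ys t \<Longrightarrow> ys = xs \<and> t = s"
proof (induction arbitrary: y t and ys t rule: eval_evals.inducts)
  case (eval_Var i env)
  then show ?case by (auto elim: eval.cases)
next
  case (eval_Leaf env)
  then show ?case by (auto elim: eval.cases)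
next
  case (eval_Node env e1 x s e2 x' s')
  from eval_Node.prems show ?case
    by cases (use eval_Node.IH in blast)
next
  case (eval_Fst env e x s)
  from eval_Fst.prems show ?case
    by cases (use eval_Fst.IH in blast)
next
  case (eval_Snd env e x s)
  from eval_Snd.prems show ?case
    by cases (use eval_Snd.IH in blast)
next
  case (eval_If_Node env b x s e1 x' s' e2)
  from eval_If_Node.prems show ?case
    by cases (use eval_If_Node.IH eval_If_Node.hyps in blast)+
next
  case (eval_If_Leaf env b s e2 x' s' e1)
  from eval_If_Leaf.prems show ?case
    by cases (use eval_If_Leaf.IH in blast)+
next
  case (eval_Let env e1 x s e2 x' s')
  from eval_Let.prems show ?case
    by cases (use eval_Let.IH in blast)
next
  case (eval_Call f env es xs s x s')
  from eval_Call.prems show ?case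
    by cases (use eval_Call.IH in blast)
next
  case (evals_Nil env)
  then show ?case by (auto elim: evals.cases)
next
  case (evals_Cons env e x s es xs s')
  from evals_Cons.prems show ?case
    by cases (use evals_Cons.IH in blast)
qed

text \<open>Execution starts with the first function of the program, applied to the input.\<close>

definition computes_in :: "program \<Rightarrow> data \<Rightarrow> data \<Rightarrow> nat \<Rightarrow> bool" where
  "computes_in P x y t \<longleftrightarrow> P \<noteq> [] \<and> eval P [x] (P ! 0) y t"

text \<open>
  Search problems: \<open>X\<close> is the set of admissible inputs and \<open>sol x y\<close> says that \<open>y\<close> is a correct
  answer for \<open>x\<close>. The encoding of an answer may refer to the input. The size of the input is the
  number of \<open>Node\<close>s in its encoding. By determinism, the output and the time are unique.
\<close>

definition solvable_in_polynomial_time ::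
    "'i set \<Rightarrow> ('i \<Rightarrow> data) \<Rightarrow> ('i \<Rightarrow> 's \<Rightarrow> data) \<Rightarrow> ('i \<Rightarrow> 's \<Rightarrow> bool) \<Rightarrow> bool" where
  "solvable_in_polynomial_time X enc_in enc_out sol \<longleftrightarrow>
     (\<exists>(P :: program) (p :: nat poly). \<forall>x\<in>X. \<exists>y t.
        sol x y \<and> computes_in P (enc_in x) (enc_out x y) t \<and> t \<le> poly p (size (enc_in x)))"


section \<open>Encodings\<close>

definition enc_bool :: "bool \<Rightarrow> data" where
  "enc_bool b = (if b then Node Leaf Leaf else Leaf)"

fun enc_list :: "('a \<Rightarrow> data) \<Rightarrow> 'a list \<Rightarrow> data" where
  "enc_list enc [] = Leaf"
| "enc_list enc (x # xs) = Node (enc x) (enc_list enc xs)"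

text \<open>Binary digits, least significant first.\<close>

fun bits :: "nat \<Rightarrow> bool list" where
  "bits n = (if n = 0 then [] else odd n # bits (n div 2))"

declare bits.simps [simp del]

definition enc_nat :: "nat \<Rightarrow> data" where
  "enc_nat n = enc_list enc_bool (bits n)"

definition enc_nonneg_rat :: "rat \<Rightarrow> data" where
  "enc_nonneg_rat q =
     Node (enc_nat (nat (fst (quotient_of q)))) (enc_nat (nat (snd (quotient_of q))))"

text \<open>
  With the vertices in increasing order, an instance is encoded as the list with one entry per
  vertex: its row of the adjacency matrix, its weight (numerator and denominator in lowest
  terms, in binary), and the indicator vector of its list over the colors \<open>1, \<dots>, r\<close>.
  A vertex set is encoded by its indicator vector.
\<close>

definition vertex_list :: "mwlcis \<Rightarrow> nat list" where
  "vertex_list I = sorted_list_of_set (verts (inst_graph I))"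

definition enc_vertex :: "nat \<Rightarrow> mwlcis \<Rightarrow> nat \<Rightarrow> data" where
  "enc_vertex r I v =
     Node (enc_list (\<lambda>u. enc_bool ({v, u} \<in> edges (inst_graph I))) (vertex_list I))
       (Node (enc_nonneg_rat (inst_weight I v))
         (enc_list (\<lambda>c. enc_bool (c \<in> inst_lists I v)) [1..<Suc r]))"

definition enc_mwlcis :: "nat \<Rightarrow> mwlcis \<Rightarrow> data" where
  "enc_mwlcis r I = enc_list (enc_vertex r I) (vertex_list I)"

definition enc_vertex_set :: "mwlcis \<Rightarrow> nat set \<Rightarrow> data" where
  "enc_vertex_set I F = enc_list (\<lambda>v. enc_bool (v \<in> F)) (vertex_list I)"

end

theory Submission
  imports Defs "HOL-Library.More_List"
begin

text \<open>
  A color class is an independent set, and in a \<open>kP\<^sub>3\<close>-free graph every independent set lies in one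
  of polynomially many vertex sets that induce \<open>P\<^sub>3\<close>-free graphs, that is, disjoint unions of cliques.
  Such a family is built by adding the vertices one by one: if \<open>I\<close> contains the new vertex \<open>v\<close> and
  \<open>I - {v}\<close> is covered by \<open>S\<close>, but \<open>S \<union> {v}\<close> induces a \<open>P\<^sub>3\<close>, then there is a \<open>P\<^sub>3\<close> \<open>T\<close> through \<open>v\<close>
  such that \<open>I - T\<close> is anticomplete to \<open>T\<close>, so that \<open>I - T\<close> lies in a \<open>(k-1)P\<^sub>3\<close>-free graph and is
  covered recursively.

  Once a member of the family has been fixed for each of the \<open>r\<close> colors, a color class is a choice of
  at most one vertex from each clique of its member. An optimal list-colored subgraph is therefore a
  matching between vertices and pairs of a color and a clique that maximizes the weight of
  the matched vertices. Such a matching is found by adding the vertices one by one and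
  exchanging along alternating paths. The best solution over all \<open>r\<close>-tuples of members is optimal.

  Polynomial running time is established without writing programs: functions on encodable types
  that are computable in polynomial time with polynomially bounded output are closed under
  composition and under recursion on lists, provided the size of the recursively defined value is
  polynomially bounded.
\<close>


section \<open>Programs as a calculus of polynomial-time functions\<close>

text \<open>Both \<open>k\<close> and \<open>r\<close> are constants of the program, so they may
  enter the exponent of the running time.

  The matching step weighs vertices only, and the vertex sets that can be matched form a transversal
  matroid. Hence, when a vertex \<open>v\<close> arrives, some new optimum is the old one with
  \<open>v\<close> added and at most one vertex removed. The search has to remember only which
  vertex is currently unmatched (the hole), with one representative state per hole; this keeps the
  number of states linear and replaces an enumeration of alternating paths.

  The cliques serve only the analysis. The program tests adjacency and equality of colors, and the
  structure of the conflicts follows from the \<open>P_3\<close>-freeness of the chosen members.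

  Time bounds are claimed for every value of the input type, also for lists of rows that encode no
  graph. The size estimates for search states and covers therefore use no graph hypothesis and are
  kept apart from correctness.\<close>

lemmas eval_intros = eval_evals.intros[simplified]

text \<open>Variables count from the front of the environment and a call replaces it, so entries
  appended at the end are invisible. Code written for a one-entry environment can thus run under
  additional bindings.\<close>

lemma eval_append_env:
  "eval P env e y t \<Longrightarrow> eval P (env @ env') e y t"
  "evals P env es ys t \<Longrightarrow> evals P (env @ env') es ys t"
proof (induction rule: eval_evals.inducts)
  case (eval_Var i env)
  then show ?case
    using eval_evals.eval_Var[of i "env @ env'" P] by (simp add: nth_append)
qed (auto intro: eval_intros)

text \<open>Function names are positions in the program, so code placed behind \<open>k\<close>
  other functions has to be relocated by \<open>k\<close>.\<close>

fun shift_calls :: "nat \<Rightarrow> exp \<Rightarrow> exp" where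
  "shift_calls k (EVar i) = EVar i"
| "shift_calls k ELeaf = ELeaf"
| "shift_calls k (ENode a b) = ENode (shift_calls k a) (shift_calls k b)"
| "shift_calls k (EFst a) = EFst (shift_calls k a)"
| "shift_calls k (ESnd a) = ESnd (shift_calls k a)"
| "shift_calls k (EIf a b c) = EIf (shift_calls k a) (shift_calls k b) (shift_calls k c)"
| "shift_calls k (ELet a b) = ELet (shift_calls k a) (shift_calls k b)"
| "shift_calls k (ECall f es) = ECall (f + k) (map (shift_calls k) es)"

lemma eval_shift_calls:
  assumes "\<And>f. f < length P \<Longrightarrow> f + k < length Q \<and> Q ! (f + k) = shift_calls k (P ! f)"
  shows "eval P env e y t \<Longrightarrow> eval Q env (shift_calls k e) y t"
    and "evals P env es ys t \<Longrightarrow> evals Q env (map (shift_calls k) es) ys t"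
proof (induction rule: eval_evals.inducts)
  case (eval_Call f env es xs s y t)
  then show ?case
    using assms[of f] eval_evals.eval_Call[of "f + k" Q env "map (shift_calls k) es" xs s y t] by simp
qed (auto intro: eval_intros)

lemma eval_append_program: "eval P env e y t \<Longrightarrow> eval (P @ Q) env e y t"
proof -
  have id: "shift_calls 0 e = e" for e
    by (induction e) (auto intro: map_idI)
  assume "eval P env e y t"
  from eval_shift_calls(1)[OF _ this, of 0 "P @ Q"] show ?thesis
    by (simp add: id nth_append)
qed

lemma eval_link_right:
  "eval Q env e y t \<Longrightarrow>
    eval (P @ map (shift_calls (length P)) Q) env (shift_calls (length P) e) y t"
  by (rule eval_shift_calls(1)) (auto simp: nth_append)

section \<open>Types whose values are encoded as binary trees\<close>

class encodable =
  fixes enc :: "'a \<Rightarrow> data"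

abbreviation sz :: "'a::encodable \<Rightarrow> nat" where
  "sz x \<equiv> size (enc x)"

instantiation unit :: encodable
begin
definition enc_unit: "enc (x :: unit) = Leaf"
instance ..
end

instantiation bool :: encodable
begin
definition enc_Bool: "enc (b :: bool) = enc_bool b"
instance ..
end

instantiation prod :: (encodable, encodable) encodable
begin
definition enc_prod: "enc p = Node (enc (fst p)) (enc (snd p))"
instance ..
end

instantiation list :: (encodable) encodable
begin
definition enc_List: "enc (xs :: 'a list) = enc_list enc xs"
instance ..
end

text \<open>Numbers of this instance are unary: they serve as vertex and color indices, whereas the
  binary numerators and denominators of weights are treated as lists of bits.\<close>

instantiation nat :: encodable
begin
definition enc_unary: "enc (n :: nat) = enc (replicate n ())"
instance ..
end

lemma enc_simps [simp]:
  "enc () = Leaf"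
  "enc True = Node Leaf Leaf"
  "enc False = Leaf"
  "enc (x, y) = Node (enc x) (enc y)"
  "enc ([] :: 'a::encodable list) = Leaf"
  "enc (z # zs) = Node (enc z) (enc zs)"
  "enc (0 :: nat) = Leaf"
  "enc (Suc n) = Node Leaf (enc n)"
  for x :: "'a::encodable" and y :: "'b::encodable" and z :: "'c::encodable"
  by (auto simp: enc_unit enc_Bool enc_bool_def enc_prod enc_List enc_unary)


lemma sz_nat [simp]: "sz (n :: nat) = n"
  by (induction n) auto

lemma sz_list: "sz xs = length xs + sum_list (map sz xs)"
  by (induction xs) auto

lemma length_le_sz: "length xs \<le> sz xs"
  by (simp add: sz_list)

lemma sz_list_le:
  assumes "\<And>x. x \<in> set xs \<Longrightarrow> sz x \<le> b"
  shows "sz xs \<le> length xs * Suc b"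
  using assms
proof (induction xs)
  case (Cons x xs)
  then have "sz x \<le> b" "sz xs \<le> length xs * Suc b" by auto
  then show ?case by simp
qed simp

lemma sz_mem_le: "x \<in> set xs \<Longrightarrow> sz x \<le> sz xs"
  by (induction xs) auto

lemma sz_append [simp]: "sz (xs @ ys) = sz xs + sz ys"
  by (induction xs) auto

lemma sz_filter_le: "sz (filter P xs) \<le> sz xs"
  by (induction xs) auto

lemma sz_bool_le: "sz (b :: bool) \<le> 1"
  by (cases b) auto

section \<open>Polynomial bounds and the basic closure rules\<close>

definition pbounded :: "('a::encodable \<Rightarrow> nat) \<Rightarrow> bool" where
  "pbounded B \<longleftrightarrow> (\<exists>p. \<forall>x. B x \<le> poly p (sz x))"

text \<open>The size bound is not implied by the time bound, because shared subtrees allow outputs of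
  exponential size.\<close>

definition ptime :: "('a::encodable \<Rightarrow> 'b::encodable) \<Rightarrow> bool" where
  "ptime f \<longleftrightarrow> pbounded (\<lambda>x. sz (f x)) \<and>
     (\<exists>P e T. pbounded T \<and> (\<forall>x. \<exists>t\<le>T x. eval P [enc x] e (enc (f x)) t))"

named_theorems pbounded_intros
named_theorems ptime_intros

lemma poly_mono_nat: "x \<le> y \<Longrightarrow> poly p x \<le> poly p (y :: nat)"
  by (induction p) (auto intro!: add_mono mult_le_mono)

lemma pbounded_mono: "pbounded C \<Longrightarrow> (\<And>x. B x \<le> C x) \<Longrightarrow> pbounded B"
  unfolding pbounded_def by (meson le_trans)

lemma pbounded_const [pbounded_intros]: "pbounded (\<lambda>_. n)"
  unfolding pbounded_def by (rule exI[of _ "[:n:]"]) simp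

lemma pbounded_sz [pbounded_intros]: "ptime f \<Longrightarrow> pbounded (\<lambda>x. sz (f x))"
  by (simp add: ptime_def)

lemma pbounded_add [pbounded_intros]:
  assumes "pbounded B" "pbounded C" shows "pbounded (\<lambda>x. B x + C x)"
proof -
  obtain p q where "\<And>x. B x \<le> poly p (sz x)" "\<And>x. C x \<le> poly q (sz x)"
    using assms unfolding pbounded_def by blast
  then have "\<forall>x. B x + C x \<le> poly (p + q) (sz x)" by (auto intro: add_mono)
  then show ?thesis unfolding pbounded_def by blast
qed

lemma pbounded_mult [pbounded_intros]:
  assumes "pbounded B" "pbounded C" shows "pbounded (\<lambda>x. B x * C x)"
proof -
  obtain p q where "\<And>x. B x \<le> poly p (sz x)" "\<And>x. C x \<le> poly q (sz x)"
    using assms unfolding pbounded_def by blast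
  then have "\<forall>x. B x * C x \<le> poly (p * q) (sz x)" by (auto intro: mult_le_mono)
  then show ?thesis unfolding pbounded_def by blast
qed

lemma pbounded_Suc [pbounded_intros]: "pbounded B \<Longrightarrow> pbounded (\<lambda>x. Suc (B x))"
  using pbounded_add[OF _ pbounded_const[of 1]] by force

lemma pbounded_poly [pbounded_intros]:
  assumes "pbounded B" shows "pbounded (\<lambda>x. poly p (B x))"
proof -
  obtain q where "\<And>x. B x \<le> poly q (sz x)"
    using assms unfolding pbounded_def by blast
  then have "\<forall>x. poly p (B x) \<le> poly (pcompose p q) (sz x)"
    by (auto simp: poly_pcompose intro: poly_mono_nat)
  then show ?thesis unfolding pbounded_def by blast
qed

lemma pbounded_comp:
  assumes "pbounded B" "ptime f" shows "pbounded (\<lambda>x. B (f x))"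
proof -
  obtain p where "\<And>x. B x \<le> poly p (sz x)"
    using assms unfolding pbounded_def by blast
  then show ?thesis
    by (intro pbounded_mono[OF pbounded_poly[OF pbounded_sz[OF assms(2)]]])
qed

lemma ptimeI:
  assumes "\<And>x. \<exists>t\<le>T x. eval P [enc x] e (enc (f x)) t" "pbounded T" "pbounded (\<lambda>x. sz (f x))"
  shows "ptime f"
  unfolding ptime_def using assms by blast

text \<open>Relocating the second program behind the first gives one program in which both
  expressions run; the closure rules with two ingredients start from it.\<close>

lemma ptime_link:
  assumes "ptime f" "ptime g"
  obtains P ef eg Tf Tg where "pbounded Tf" "pbounded Tg"
    "\<And>x. \<exists>t\<le>Tf x. eval P [enc x] ef (enc (f x)) t"
    "\<And>x. \<exists>t\<le>Tg x. eval P [enc x] eg (enc (g x)) t"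
proof -
  obtain P e T where f: "pbounded T" "\<And>x. \<exists>t\<le>T x. eval P [enc x] e (enc (f x)) t"
    using assms(1) unfolding ptime_def by blast
  obtain P' e' T' where g: "pbounded T'" "\<And>x. \<exists>t\<le>T' x. eval P' [enc x] e' (enc (g x)) t"
    using assms(2) unfolding ptime_def by blast
  show ?thesis
    by (rule that[OF f(1) g(1), of "P @ map (shift_calls (length P)) P'" e
          "shift_calls (length P) e'"])
      (use f(2) g(2) in \<open>blast intro: eval_append_program eval_link_right\<close>)+
qed

lemma ptime_id [ptime_intros]: "ptime (\<lambda>x. x)"
proof (rule ptimeI)
  show "\<exists>t\<le>1. eval [] [enc x] (EVar 0) (enc x) t" for x :: 'a
    using eval_intros(1)[of 0 "[enc x]"] by auto
  show "pbounded (\<lambda>x :: 'a. sz x)"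
    unfolding pbounded_def by (rule exI[of _ "[:0, 1:]"]) simp
qed (rule pbounded_const)

fun quote :: "data \<Rightarrow> exp" where
  "quote Leaf = ELeaf"
| "quote (Node x y) = ENode (quote x) (quote y)"

lemma ptime_const [ptime_intros]: "ptime (\<lambda>_ :: 'a::encodable. c)"
proof (rule ptimeI)
  \<comment> \<open>A binary tree with \<open>size d\<close> inner nodes has one leaf more, and
    every node or leaf costs one step.\<close>
  have "eval [] env (quote d) d (2 * size d + 1)" for d env
  proof (induction d)
    case (Node x y)
    then show ?case using eval_intros(3)[OF Node] by (simp add: algebra_simps)
  qed (auto intro: eval_intros)
  then show "\<exists>t\<le>2 * sz c + 1. eval [] [enc x] (quote (enc c)) (enc c) t" for x :: 'a
    by blast
qed (intro pbounded_intros)+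

lemma ptime_pair [ptime_intros]:
  assumes "ptime f" "ptime g" shows "ptime (\<lambda>x. (f x, g x))"
proof -
  obtain P ef eg Tf Tg where *: "pbounded Tf" "pbounded Tg"
    "\<And>x. \<exists>t\<le>Tf x. eval P [enc x] ef (enc (f x)) t"
    "\<And>x. \<exists>t\<le>Tg x. eval P [enc x] eg (enc (g x)) t"
    using ptime_link[OF assms] by metis
  show ?thesis
  proof (rule ptimeI)
    fix x
    obtain s t where "eval P [enc x] ef (enc (f x)) s" "eval P [enc x] eg (enc (g x)) t"
      and "s \<le> Tf x" "t \<le> Tg x" using * by blast
    then show "\<exists>t\<le>Suc (Tf x + Tg x). eval P [enc x] (ENode ef eg) (enc (f x, g x)) t"
      using eval_intros(3) by (auto intro!: exI[of _ "Suc (s + t)"])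
  next
    have "pbounded (\<lambda>x. Suc (sz (f x) + sz (g x)))" by (intro pbounded_intros assms)
    then show "pbounded (\<lambda>x. sz (f x, g x))" by simp
  qed (intro pbounded_intros *)
qed

text \<open>The value of \<open>f\<close> becomes variable 0 of the code for \<open>g\<close>, with
  the old argument hidden behind it. The time of \<open>g\<close> stays polynomial in the input
  because \<open>ptime\<close> also bounds the size of \<open>f x\<close>.\<close>

lemma ptime_comp:
  assumes "ptime g" "ptime f" shows "ptime (\<lambda>x. g (f x))"
proof -
  obtain P ef eg Tf Tg where *: "pbounded Tf" "pbounded Tg"
    "\<And>x. \<exists>t\<le>Tf x. eval P [enc x] ef (enc (f x)) t"
    "\<And>x. \<exists>t\<le>Tg x. eval P [enc x] eg (enc (g x)) t"
    using ptime_link[OF assms(2,1)] by metis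
  show ?thesis
  proof (rule ptimeI)
    fix x
    obtain s t where "eval P [enc x] ef (enc (f x)) s" "eval P [enc (f x)] eg (enc (g (f x))) t"
      and "s \<le> Tf x" "t \<le> Tg (f x)" using * by blast
    then show "\<exists>t\<le>Suc (Tf x + Tg (f x)). eval P [enc x] (ELet ef eg) (enc (g (f x))) t"
      using eval_intros(8)[of P "[enc x]" ef "enc (f x)" s eg _ t]
        eval_append_env(1)[of P "[enc (f x)]" eg _ t "[enc x]"]
      by (auto intro!: exI[of _ "Suc (s + t)"])
  next
    show "pbounded (\<lambda>x. sz (g (f x)))"
      by (rule pbounded_comp[OF pbounded_sz[OF assms(1)] assms(2)])
  next
    show "pbounded (\<lambda>x. Suc (Tf x + Tg (f x)))"
      by (intro pbounded_Suc pbounded_add *(1) pbounded_comp[OF *(2) assms(2)])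
  qed
qed

text \<open>The language has no function values: a functional argument is represented by an
  uncurried function whose first component carries the parameters of the context.\<close>

lemma ptime_comp2:
  assumes "ptime (\<lambda>z. f (fst z) (snd z))" "ptime u" "ptime v"
  shows "ptime (\<lambda>x. f (u x) (v x))"
  using ptime_comp[OF assms(1) ptime_pair[OF assms(2,3)]] by simp

lemma ptime_Let [ptime_intros]:
  assumes "ptime f" "ptime (\<lambda>z. g (fst z) (snd z))"
  shows "ptime (\<lambda>x. let y = f x in g x y)"
  using ptime_comp2[OF assms(2) ptime_id assms(1)] by simp

lemma ptime_fst [ptime_intros]:
  assumes "ptime f" shows "ptime (\<lambda>x. fst (f x))"
proof -
  have "ptime (fst :: 'b \<times> 'c \<Rightarrow> 'b)"
  proof (rule ptimeI)
    fix x :: "'b \<times> 'c"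
    show "\<exists>t\<le>2. eval [] [enc x] (EFst (EVar 0)) (enc (fst x)) t"
      using eval_intros(4)[OF eval_intros(1)[of 0 "[enc x]"]] by (cases x) (auto intro!: exI[of _ 2] simp: numeral_2_eq_2)
  next
    show "pbounded (\<lambda>x :: 'b \<times> 'c. sz (fst x))"
      by (rule pbounded_mono[OF pbounded_sz[OF ptime_id]]) auto
  qed (rule pbounded_const)
  from ptime_comp[OF this assms] show ?thesis .
qed

lemma ptime_snd [ptime_intros]:
  assumes "ptime f" shows "ptime (\<lambda>x. snd (f x))"
proof -
  have "ptime (snd :: 'b \<times> 'c \<Rightarrow> 'c)"
  proof (rule ptimeI)
    fix x :: "'b \<times> 'c"
    show "\<exists>t\<le>2. eval [] [enc x] (ESnd (EVar 0)) (enc (snd x)) t"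
      using eval_intros(5)[OF eval_intros(1)[of 0 "[enc x]"]] by (cases x) (auto intro!: exI[of _ 2] simp: numeral_2_eq_2)
  next
    show "pbounded (\<lambda>x :: 'b \<times> 'c. sz (snd x))"
      by (rule pbounded_mono[OF pbounded_sz[OF ptime_id]]) auto
  qed (rule pbounded_const)
  from ptime_comp[OF this assms] show ?thesis .
qed

lemma ptime_Cons [ptime_intros]:
  assumes "ptime f" "ptime g" shows "ptime (\<lambda>x. f x # g x)"
  using ptime_pair[OF assms] unfolding ptime_def by simp

lemma ptime_Suc [ptime_intros]:
  assumes "ptime f" shows "ptime (\<lambda>x. Suc (f x))"
  using ptime_pair[OF ptime_const[of "()"] assms] unfolding ptime_def by simp

lemma ptime_if [ptime_intros]:
  assumes "ptime b" "ptime f" "ptime g" shows "ptime (\<lambda>x. if b x then f x else g x)"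
proof -
  obtain P e1 e2 T1 T2 where *: "pbounded T1" "pbounded T2"
    "\<And>x. \<exists>t\<le>T1 x. eval P [enc x] e1 (enc (b x)) t"
    "\<And>x. \<exists>t\<le>T2 x. eval P [enc x] e2 (enc (f x, g x)) t"
    using ptime_link[OF assms(1) ptime_pair[OF assms(2,3)]] by metis
  \<comment> \<open>\<open>ptime_link\<close> merges only two programs, so both branches are
    computed as a pair and the test merely selects a component.\<close>
  let ?e = "EIf e1 (EFst e2) (ESnd e2)"
  show ?thesis
  proof (rule ptimeI)
    fix x
    obtain s t where st: "eval P [enc x] e1 (enc (b x)) s"
      "eval P [enc x] e2 (enc (f x, g x)) t" "s \<le> T1 x" "t \<le> T2 x"
      using * by blast
    show "\<exists>t\<le>Suc (Suc (T1 x + T2 x)). eval P [enc x] ?e (enc (if b x then f x else g x)) t"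
    proof (cases "b x")
      case True
      with st show ?thesis
        using eval_intros(6)[OF _ _ eval_intros(4)[OF st(2)]]
        by (auto intro!: exI[of _ "Suc (Suc (s + t))"])
    next
      case False
      with st show ?thesis
        using eval_intros(7)[OF _ eval_intros(5)[OF st(2)]]
        by (auto intro!: exI[of _ "Suc (Suc (s + t))"])
    qed
  next
    have "pbounded (\<lambda>x. sz (f x) + sz (g x))" by (intro pbounded_intros assms)
    then show "pbounded (\<lambda>x. sz (if b x then f x else g x))"
      by (rule pbounded_mono) auto
  qed (intro pbounded_intros *)
qed

text \<open>A nonempty list and the pair of its head and tail have the same encoding, so in the
  second case the argument already has the form that the code for \<open>s\<close> expects.\<close>

lemma ptime_case_list [ptime_intros]:
  assumes "ptime l" "ptime a" "ptime (\<lambda>z. s (fst z) (fst (snd z)) (snd (snd z)))"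
  shows "ptime (\<lambda>x. case l x of [] \<Rightarrow> a x | y # ys \<Rightarrow> s x y ys)"
proof -
  let ?s = "\<lambda>z. s (fst z) (fst (snd z)) (snd (snd z))"
  have a: "ptime (\<lambda>z :: 'a \<times> 'b list. a (fst z))"
    by (intro ptime_comp[OF assms(2)] ptime_intros)
  obtain P ea es Ta Ts where *: "pbounded Ta" "pbounded Ts"
    "\<And>x :: 'a \<times> 'b list. \<exists>t\<le>Ta x. eval P [enc x] ea (enc (a (fst x))) t"
    "\<And>x. \<exists>t\<le>Ts x. eval P [enc x] es (enc (?s x)) t"
    using ptime_link[OF a assms(3)] by metis
  let ?e = "EIf (ESnd (EVar 0)) es ea"
  let ?g = "\<lambda>z. case snd z of [] \<Rightarrow> a (fst z) | y # ys \<Rightarrow> s (fst z) y ys"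
  obtain pa ps where p: "\<And>x. Ta x \<le> poly pa (sz x)" "\<And>x. Ts x \<le> poly ps (sz x)"
    using * unfolding pbounded_def by blast
  obtain qa qs where q: "\<And>x. sz (a x) \<le> poly qa (sz x)" "\<And>x. sz (?s x) \<le> poly qs (sz x)"
    using assms(2,3)[THEN pbounded_sz] unfolding pbounded_def by blast
  have "ptime ?g"
  proof (rule ptimeI)
    fix z :: "'a \<times> 'b list"
    obtain x l where z: "z = (x, l)" by (cases z)
    have v: "eval P [enc z] (ESnd (EVar 0)) (enc l) 2"
      using eval_intros(5)[OF eval_intros(1)[of 0 "[enc z]"]] by (simp add: z numeral_2_eq_2)
    show "\<exists>t\<le>Suc (Suc (Suc (Ta z + poly ps (sz z)))). eval P [enc z] ?e (enc (?g z)) t"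
    proof (cases l)
      case Nil
      obtain t where "eval P [enc z] ea (enc (a x)) t" "t \<le> Ta z" using *(3)[of z] z by auto
      then show ?thesis using eval_intros(7)[of P "[enc z]" _ 2 ea "enc (a x)" t es] v Nil z
        by (auto intro!: exI[of _ "Suc (2 + t)"])
    next
      case (Cons y ys)
      obtain t where t: "eval P [enc (x, y, ys)] es (enc (s x y ys)) t" "t \<le> Ts (x, y, ys)"
        using *(4)[of "(x, y, ys)"] by auto
      moreover have "enc (x, y, ys) = enc z" by (simp add: z Cons)
      moreover have "Ts (x, y, ys) \<le> poly ps (sz z)" using p(2)[of "(x, y, ys)"] by (simp add: z Cons)
      ultimately show ?thesis using eval_intros(6)[of P "[enc z]" _ "enc l" 2 es _ t ea] v Cons z
        by (auto intro!: exI[of _ "Suc (2 + t)"])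
    qed
  next
    have "pbounded (\<lambda>z :: 'a \<times> 'b list. poly qa (sz (fst z)) + poly qs (sz z))"
      by (intro pbounded_intros ptime_intros)
    then show "pbounded (\<lambda>z. sz (?g z))"
    proof (rule pbounded_mono)
      fix z :: "'a \<times> 'b list"
      show "sz (?g z) \<le> poly qa (sz (fst z)) + poly qs (sz z)"
        using q(1)[of "fst z"] q(2)[of "(fst z, hd (snd z), tl (snd z))"]
        by (cases z; cases "snd z") auto
    qed
  qed (intro pbounded_intros ptime_intros *)
  from ptime_comp[OF this ptime_pair[OF ptime_id assms(1)]] show ?thesis
    by (simp cong: list.case_cong)
qed


section \<open>Recursion on lists and on unary numbers\<close>

lemma evals_pair_intro:
  "eval P env e1 x s \<Longrightarrow> eval P env e2 y t \<Longrightarrow>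
    evals P env [e1, e2] [x, y] (Suc (s + Suc (t + 1)))"
  using eval_intros(11)[OF _ eval_intros(11)[OF _ eval_intros(10)]] by simp

text \<open>The recursion becomes a new function behind the linked program that calls itself. The
  size hypothesis on \<open>g\<close> is essential: a polynomial-time step that doubles its last
  argument would produce values of exponential size.\<close>

theorem ptime_list_rec:
  fixes g :: "'a::encodable \<Rightarrow> 'b::encodable list \<Rightarrow> 'c::encodable"
  assumes Nil: "\<And>x. g x [] = a x"
    and Cons: "\<And>x y ys. g x (y # ys) = s x y ys (g x ys)"
    and a: "ptime a"
    and s: "ptime (\<lambda>z. s (fst z) (fst (snd z)) (fst (snd (snd z))) (snd (snd (snd z))))"
    and g: "pbounded (\<lambda>z. sz (g (fst z) (snd z)))"
    and u: "ptime u" and l: "ptime l"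
  shows "ptime (\<lambda>x. g (u x) (l x))"
proof -
  let ?s = "\<lambda>z. s (fst z) (fst (snd z)) (fst (snd (snd z))) (snd (snd (snd z)))"
  obtain P ea es Ta Ts where *: "pbounded Ta" "pbounded Ts"
    "\<And>x. \<exists>t\<le>Ta x. eval P [enc x] ea (enc (a x)) t"
    "\<And>x. \<exists>t\<le>Ts x. eval P [enc x] es (enc (?s x)) t"
    using ptime_link[OF a s] by metis
  obtain pa ps where p: "\<And>x. Ta x \<le> poly pa (sz x)" "\<And>x. Ts x \<le> poly ps (sz x)"
    using * unfolding pbounded_def by blast
  obtain q where q: "\<And>x l. sz (g x l) \<le> poly q (sz (x, l))"
    using g unfolding pbounded_def by (metis fst_conv snd_conv)
  define k where "k = length P"
  define rec where "rec = ECall k [EVar 0, ESnd (EVar 1)]"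
  define body where "body = EIf (EVar 1)
    (ELet (ENode (EVar 0) (ENode (EFst (EVar 1)) (ENode (ESnd (EVar 1)) rec))) es) ea"
  define Q where "Q = P @ [body]"
  have v0: "eval Q [x, y] (EVar 0) x 1" and v1: "eval Q [x, y] (EVar 1) y 1" for x y
    using eval_intros(1)[of 0 "[x, y]" Q] eval_intros(1)[of 1 "[x, y]" Q] by auto
  \<comment> \<open>Cost of one level: \<open>Suc (m + poly q m)\<close> bounds the size of the
    tuple of parameter, head, tail and recursive value, and 20 absorbs the constant overhead of
    tests, projections and the call.\<close>
  define C where "C m = poly pa m + poly ps (Suc (m + poly q m)) + 20" for m
  \<comment> \<open>The bound \<open>m\<close> is fixed during the induction, so every level costs
    at most \<open>C m\<close> although the levels see different tails.\<close>
  have run: "\<exists>t\<le>Suc (length l) * C m. eval Q [enc x, enc l] body (enc (g x l)) t"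
    if "sz (x, l) \<le> m" for x l m
    using that
  proof (induction l)
    case Nil
    obtain t where t: "eval P [enc x] ea (enc (a x)) t" "t \<le> Ta x" using *(3) by blast
    from t(1) have "eval Q ([enc x] @ [enc ([] :: 'b list)]) ea (enc (a x)) t"
      unfolding Q_def by (intro eval_append_env eval_append_program)
    then have "eval Q [enc x, enc ([] :: 'b list)] body (enc (g x [])) (Suc (1 + t))"
      unfolding body_def using v1[of "enc x" Leaf]
      by (intro eval_intros(7)) (simp_all add: assms(1))
    moreover have "Ta x \<le> poly pa m"
      using p(1)[of x] poly_mono_nat[of "sz x" m pa] Nil.prems by simp
    ultimately show ?case using t(2) by (auto intro!: exI[of _ "Suc (1 + t)"] simp: C_def)
  next
    case (Cons y ys)
    then obtain t where t: "t \<le> Suc (length ys) * C m" "eval Q [enc x, enc ys] body (enc (g x ys)) t"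
      by auto
    let ?r = "g x ys" and ?env = "[enc x, enc (y # ys)]"
    let ?z = "(x, y, ys, ?r)"
    obtain t' where t': "eval P [enc ?z] es (enc (?s ?z)) t'" "t' \<le> Ts ?z" using *(4)[of ?z] by blast
    from t'(1) have E: "eval Q ([enc ?z] @ ?env) es (enc (?s ?z)) t'"
      unfolding Q_def by (intro eval_append_env eval_append_program)
    have tl: "eval Q ?env (ESnd (EVar 1)) (enc ys) 2" and hd: "eval Q ?env (EFst (EVar 1)) (enc y) 2"
      using eval_intros(5)[OF v1[of "enc x" "enc (y # ys)"]] eval_intros(4)[OF v1[of "enc x" "enc (y # ys)"]]
      by (simp_all add: numeral_2_eq_2)
    have "eval Q ?env rec (enc ?r) (Suc (Suc (1 + Suc (2 + 1)) + t))"
      unfolding rec_def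
      by (rule eval_intros(9)[OF _ evals_pair_intro[OF v0 tl]]) (use t(2) in \<open>simp_all add: Q_def k_def\<close>)
    from eval_intros(3)[OF v0 eval_intros(3)[OF hd eval_intros(3)[OF tl this]]]
    have "eval Q ?env (ENode (EVar 0) (ENode (EFst (EVar 1)) (ENode (ESnd (EVar 1)) rec))) (enc ?z)
      (t + 15)" by (simp add: numeral_eq_Suc)
    from eval_intros(8)[OF this E[simplified append_Cons append_Nil]]
    have "eval Q ?env body (enc (g x (y # ys))) (Suc (1 + Suc (t + 15 + t')))"
      unfolding body_def by (intro eval_intros(6)[OF v1]) (auto simp: assms(2))
    moreover have "Ts ?z \<le> poly ps (Suc (m + poly q m))"
    proof -
      have "sz ?r \<le> poly q m"
        using q[of x ys] poly_mono_nat[of "sz (x, ys)" m q] Cons.prems by simp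
      with Cons.prems have "sz ?z \<le> Suc (m + poly q m)" by simp
      then show ?thesis using p(2)[of ?z] poly_mono_nat le_trans by blast
    qed
    ultimately show ?case
      using t(1) t'(2) by (intro exI[of _ "Suc (1 + Suc (t + 15 + t'))"]) (auto simp: C_def)
  qed
  have "ptime (\<lambda>z. g (fst z) (snd z))"
  proof (rule ptimeI)
    fix z :: "'a \<times> 'b list"
    obtain x l where z: "z = (x, l)" by (cases z)
    obtain t where t: "t \<le> Suc (length l) * C (sz z)" "eval Q [enc x, enc l] body (enc (g x l)) t"
      using run[of x l "sz z"] z by auto
    have v: "eval Q [enc z] (EVar 0) (enc z) 1" using eval_intros(1)[of 0 "[enc z]"] by simp
    have "eval Q [enc z] (ECall k [EFst (EVar 0), ESnd (EVar 0)]) (enc (g x l))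
        (Suc (Suc (Suc 1 + Suc (Suc 1 + 1)) + t))"
      using t(2) eval_intros(4)[OF v] eval_intros(5)[OF v]
      by (intro eval_intros(9)[OF _ evals_pair_intro[of _ _ _ "enc x" _ _ "enc l"]])
        (auto simp: z Q_def k_def)
    moreover have "Suc (length l) * C (sz z) \<le> Suc (sz z) * C (sz z)"
      using length_le_sz[of l] z by (intro mult_le_mono) auto
    ultimately show "\<exists>t\<le>Suc (sz z) * C (sz z) + 20.
        eval Q [enc z] (ECall k [EFst (EVar 0), ESnd (EVar 0)]) (enc (g (fst z) (snd z))) t"
      using t(1) z by (intro exI[of _ "Suc (Suc (Suc 1 + Suc (Suc 1 + 1)) + t)"]) auto
  next
    show "pbounded (\<lambda>z :: 'a \<times> 'b list. Suc (sz z) * C (sz z) + 20)"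
      unfolding C_def by (intro pbounded_intros ptime_intros)
  qed (rule g)
  then show ?thesis by (rule ptime_comp2[OF _ u l])
qed

text \<open>A unary number and the list of units of that length have the same encoding, so
  \<open>length\<close> and \<open>replicate\<close> act as the identity on trees and recursion on
  lists applies.\<close>

theorem ptime_nat_rec:
  fixes g :: "'a::encodable \<Rightarrow> nat \<Rightarrow> 'c::encodable"
  assumes Zero: "\<And>x. g x 0 = a x"
    and Suc: "\<And>x n. g x (Suc n) = s x n (g x n)"
    and a: "ptime a"
    and s: "ptime (\<lambda>z. s (fst z) (fst (snd z)) (snd (snd z)))"
    and g: "pbounded (\<lambda>z. sz (g (fst z) (snd z)))"
    and u: "ptime u" and l: "ptime l"
  shows "ptime (\<lambda>x. g (u x) (l x))"
proof -
  have enc_length: "enc (length us) = enc us" for us :: "unit list"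
    by (induction us) auto
  have len: "ptime (\<lambda>x. length (f x))" if "ptime f" for f :: "'e::encodable \<Rightarrow> unit list"
    using that unfolding ptime_def enc_length .
  have rep: "ptime (\<lambda>x. replicate (l x) ())"
    using l unfolding ptime_def enc_length[symmetric] by simp
  have "ptime (\<lambda>x. g (u x) (length (replicate (l x) ())))"
  proof (rule ptime_list_rec[where g = "\<lambda>x us. g x (length us)" and
        s = "\<lambda>x _ us r. s x (length us) r", OF _ _ a _ _ u rep])
    show "ptime (\<lambda>z :: 'a \<times> unit \<times> unit list \<times> 'c.
        s (fst z) (length (fst (snd (snd z)))) (snd (snd (snd z))))"
      using ptime_comp[OF s, of "\<lambda>z :: 'a \<times> unit \<times> unit list \<times> 'c.
        (fst z, length (fst (snd (snd z))), snd (snd (snd z)))"]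
      by (simp add: len ptime_intros)
    have "ptime (\<lambda>z :: 'a \<times> unit list. (fst z, length (snd z)))"
      by (intro ptime_intros len)
    from pbounded_comp[OF g this] show "pbounded (\<lambda>z :: 'a \<times> unit list. sz (g (fst z) (length (snd z))))"
      by simp
  qed (simp_all add: Zero Suc)
  then show ?thesis by simp
qed


subsection \<open>Booleans, numbers and lists\<close>

lemma ptime_not [ptime_intros]: "ptime f \<Longrightarrow> ptime (\<lambda>x. \<not> f x)"
  using ptime_if[OF _ ptime_const[of False] ptime_const[of True], of f]
  by (rule back_subst[where P = ptime]) auto

lemma ptime_conj [ptime_intros]: "ptime f \<Longrightarrow> ptime g \<Longrightarrow> ptime (\<lambda>x. f x \<and> g x)"
  using ptime_if[OF _ _ ptime_const[of False], of f g]
  by (rule back_subst[where P = ptime]) auto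

lemma ptime_disj [ptime_intros]: "ptime f \<Longrightarrow> ptime g \<Longrightarrow> ptime (\<lambda>x. f x \<or> g x)"
  using ptime_not[OF ptime_conj[OF ptime_not ptime_not]] by simp

lemma ptime_iff: "ptime f \<Longrightarrow> ptime g \<Longrightarrow> ptime (\<lambda>x. f x \<longleftrightarrow> g x)"
  using ptime_if[OF _ _ ptime_not, of f g g] by (rule back_subst[where P = ptime]) auto

lemma ptime_is_zero:
  assumes "ptime f" shows "ptime (\<lambda>x. f x = (0 :: nat))"
proof -
  have "pbounded (\<lambda>z :: unit \<times> nat. sz (snd z = 0))"
    by (rule pbounded_mono[OF pbounded_const[of 1]]) (rule sz_bool_le)
  from ptime_nat_rec[where g = "\<lambda>_ n. n = 0", OF _ _ _ _ this ptime_const assms,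
      of "\<lambda>_. True" "\<lambda>_ _ _. False"]
  show ?thesis by (simp add: ptime_const)
qed

lemma ptime_pred:
  assumes "ptime f" shows "ptime (\<lambda>x. f x - 1 :: nat)"
proof -
  have "pbounded (\<lambda>z :: unit \<times> nat. sz (snd z - 1))"
    by (rule pbounded_mono[OF pbounded_sz[OF ptime_id]]) auto
  from ptime_nat_rec[where g = "\<lambda>_ n. n - 1", OF _ _ _ _ this ptime_const assms,
      of "\<lambda>_. 0" "\<lambda>_ n _. n"]
  show ?thesis by (simp add: ptime_intros)
qed

lemma ptime_diff:
  assumes "ptime f" "ptime g" shows "ptime (\<lambda>x. f x - g x :: nat)"
proof (rule ptime_nat_rec[where g = "\<lambda>m n. m - n" and a = "\<lambda>m. m" and s = "\<lambda>_ _ r. r - 1"])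
  show "pbounded (\<lambda>z :: nat \<times> nat. sz (fst z - snd z))"
    by (rule pbounded_mono[OF pbounded_sz[OF ptime_id]]) auto
qed (intro ptime_intros ptime_pred assms | simp)+

lemma ptime_nat_eq [ptime_intros]:
  assumes "ptime f" "ptime g" shows "ptime (\<lambda>x. f x = (g x :: nat))"
proof -
  have "ptime (\<lambda>x. f x - g x = 0 \<and> g x - f x = 0)"
    by (intro ptime_conj ptime_is_zero ptime_diff assms)
  then show ?thesis by (rule back_subst[where P = ptime]) auto
qed

lemma ptime_append [ptime_intros]:
  assumes "ptime f" "ptime g" shows "ptime (\<lambda>x. f x @ g x)"
proof (rule ptime_list_rec[where g = "\<lambda>ys xs. xs @ ys" and a = "\<lambda>ys. ys" and
      s = "\<lambda>_ y _ r. y # r", OF _ _ _ _ _ assms(2,1)])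
  show "pbounded (\<lambda>z :: 'b list \<times> 'b list. sz (snd z @ fst z))"
    by (rule pbounded_mono[OF pbounded_sz[OF ptime_id]]) auto
qed (intro ptime_intros | simp)+

lemma ptime_length [ptime_intros]:
  assumes "ptime f" shows "ptime (\<lambda>x. length (f x))"
proof (rule ptime_list_rec[where g = "\<lambda>_ xs. length xs" and a = "\<lambda>_. 0" and
      s = "\<lambda>_ _ _ r. Suc r", OF _ _ _ _ _ ptime_const[of "()"] assms])
  show "pbounded (\<lambda>z :: unit \<times> 'b list. sz (length (snd z)))"
    by (rule pbounded_mono[OF pbounded_sz[OF ptime_snd[OF ptime_id]]]) (simp add: length_le_sz)
qed (intro ptime_intros | simp)+

lemma ptime_rev [ptime_intros]:
  assumes "ptime f" shows "ptime (\<lambda>x. rev (f x))"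
proof (rule ptime_list_rec[where g = "\<lambda>_ xs. rev xs" and a = "\<lambda>_. []" and
      s = "\<lambda>_ y _ r. r @ [y]", OF _ _ _ _ _ ptime_const[of "()"] assms])
  have "sz (rev xs) = sz xs" for xs :: "'b list"
    by (simp add: sz_list flip: rev_map)
  then show "pbounded (\<lambda>z :: unit \<times> 'b list. sz (rev (snd z)))"
    by (simp add: pbounded_intros ptime_intros)
qed (intro ptime_intros | simp)+

lemma ptime_concat [ptime_intros]:
  assumes "ptime f" shows "ptime (\<lambda>x. concat (f x))"
proof (rule ptime_list_rec[where g = "\<lambda>_ xs. concat xs" and a = "\<lambda>_. []" and
      s = "\<lambda>_ y _ r. y @ r", OF _ _ _ _ _ ptime_const[of "()"] assms])
  have "sz (concat xs) \<le> sz xs" for xs :: "'b list list"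
    by (induction xs) auto
  then show "pbounded (\<lambda>z :: unit \<times> 'b list list. sz (concat (snd z)))"
    by (intro pbounded_mono[OF pbounded_sz[OF ptime_snd[OF ptime_id]]])
qed (intro ptime_intros | simp)+

lemma ptime_map [ptime_intros]:
  assumes f: "ptime (\<lambda>z. f (fst z) (snd z))" and l: "ptime l"
  shows "ptime (\<lambda>x. map (f x) (l x))"
proof (rule ptime_list_rec[where g = "\<lambda>x xs. map (f x) xs" and a = "\<lambda>_. []" and
      s = "\<lambda>x y _ r. f x y # r", OF _ _ _ _ _ ptime_id l])
  obtain p where p: "\<And>x y. sz (f x y) \<le> poly p (sz (x, y))"
    using pbounded_sz[OF f] unfolding pbounded_def by (metis fst_conv snd_conv)
  have "pbounded (\<lambda>z :: 'a \<times> 'b list. sz z * Suc (poly p (Suc (sz z))))"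
    by (intro pbounded_intros ptime_intros)
  then show "pbounded (\<lambda>z. sz (map (f (fst z)) (snd z)))"
  proof (rule pbounded_mono)
    fix z :: "'a \<times> 'b list"
    obtain x l where z: "z = (x, l)" by (cases z)
    have "sz (f x y) \<le> poly p (Suc (sz z))" if "y \<in> set l" for y
      using p[of x y] sz_mem_le[OF that] z
      by (auto intro: le_trans[OF _ poly_mono_nat])
    then have "sz (map (f x) l) \<le> length (map (f x) l) * Suc (poly p (Suc (sz z)))"
      by (intro sz_list_le) auto
    also have "\<dots> \<le> sz z * Suc (poly p (Suc (sz z)))"
      using length_le_sz[of l] z by (intro mult_le_mono1) simp
    finally show "sz (map (f (fst z)) (snd z)) \<le> \<dots>" by (simp add: z)
  qed
qed (intro ptime_intros ptime_comp2[OF f] | simp)+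

lemma ptime_filter [ptime_intros]:
  assumes f: "ptime (\<lambda>z. f (fst z) (snd z))" and l: "ptime l"
  shows "ptime (\<lambda>x. filter (f x) (l x))"
proof (rule ptime_list_rec[where g = "\<lambda>x xs. filter (f x) xs" and a = "\<lambda>_. []" and
      s = "\<lambda>x y _ r. if f x y then y # r else r", OF _ _ _ _ _ ptime_id l])
  show "pbounded (\<lambda>z. sz (filter (f (fst z)) (snd z)))"
    by (rule pbounded_mono[OF pbounded_sz[OF ptime_snd[OF ptime_id]]]) (rule sz_filter_le)
qed (intro ptime_intros ptime_comp2[OF f] | simp)+

lemma ptime_Ball [ptime_intros]:
  assumes f: "ptime (\<lambda>z. f (fst z) (snd z))" and l: "ptime l"
  shows "ptime (\<lambda>x. \<forall>y\<in>set (l x). f x y)"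
proof (rule ptime_list_rec[where g = "\<lambda>x xs. \<forall>y\<in>set xs. f x y" and a = "\<lambda>_. True" and
      s = "\<lambda>x y _ r. f x y \<and> r", OF _ _ _ _ _ ptime_id l])
  show "pbounded (\<lambda>z. sz (\<forall>y\<in>set (snd z). f (fst z) y))"
    by (rule pbounded_mono[OF pbounded_const[of 1]]) (rule sz_bool_le)
qed (intro ptime_intros ptime_comp2[OF f] | simp)+

lemma ptime_Bex [ptime_intros]:
  assumes f: "ptime (\<lambda>z. f (fst z) (snd z))" and l: "ptime l"
  shows "ptime (\<lambda>x. \<exists>y\<in>set (l x). f x y)"
  using ptime_not[OF ptime_Ball[OF ptime_not[OF f] l]] by simp

lemma ptime_nat_mem [ptime_intros]:
  assumes "ptime f" "ptime l" shows "ptime (\<lambda>x. (f x :: nat) \<in> set (l x))"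
proof -
  have "ptime (\<lambda>x. \<exists>y\<in>set (l x). f x = y)"
    by (intro ptime_intros assms ptime_comp[OF assms(1)])
  then show ?thesis by simp
qed

lemma ptime_foldr:
  assumes f: "ptime (\<lambda>z. f (fst z) (fst (snd z)) (snd (snd z)))" and l: "ptime l" and a: "ptime a"
    and b: "pbounded (\<lambda>z. sz (foldr (f (fst z)) (snd z) (a (fst z))))"
  shows "ptime (\<lambda>x. foldr (f x) (l x) (a x))"
proof (rule ptime_list_rec[where g = "\<lambda>x xs. foldr (f x) xs (a x)" and a = a and
      s = "\<lambda>x y _ r. f x y r", OF _ _ a _ b ptime_id l])
  show "ptime (\<lambda>z :: 'a \<times> 'b \<times> 'b list \<times> 'c. f (fst z) (fst (snd z)) (snd (snd (snd z))))"
    using ptime_comp[OF f, of "\<lambda>z :: 'a \<times> 'b \<times> 'b list \<times> 'c. (fst z, fst (snd z), snd (snd (snd z)))"]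
    by (simp add: ptime_intros)
qed simp_all

lemma ptime_funpow:
  fixes f :: "'a::encodable \<Rightarrow> 'b::encodable \<Rightarrow> 'b"
  assumes f: "ptime (\<lambda>z. f (fst z) (snd z))" and n: "ptime n" and a: "ptime a"
    and b: "pbounded (\<lambda>z. sz ((f (fst z) ^^ snd z) (a (fst z))))"
  shows "ptime (\<lambda>x. (f x ^^ n x) (a x))"
proof (rule ptime_nat_rec[where g = "\<lambda>x n. (f x ^^ n) (a x)" and a = a and
      s = "\<lambda>x _ r. f x r", OF _ _ a _ b ptime_id n])
  show "ptime (\<lambda>z :: 'a \<times> nat \<times> 'b. f (fst z) (snd (snd z)))"
    by (intro ptime_comp2[OF f] ptime_intros)
qed simp_all

text \<open>\<open>ptime_list_rec\<close> keeps the parameter fixed, so the index cannot count down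
  along the list. Instead the list is reversed and the index is compared with the length of the
  remaining tail.\<close>

fun lookup_back :: "'a \<Rightarrow> nat \<Rightarrow> 'a list \<Rightarrow> 'a" where
  "lookup_back d i [] = d"
| "lookup_back d i (y # ys) = (if i = length ys then y else lookup_back d i ys)"

lemma lookup_back_append:
  "lookup_back d i (xs @ [y]) = (case i of 0 \<Rightarrow> y | Suc j \<Rightarrow> lookup_back d j xs)"
  by (induction xs) (auto split: nat.split)

lemma nth_default_conv_lookup_back: "nth_default d xs i = lookup_back d i (rev xs)"
  by (induction xs arbitrary: i)
    (auto simp: lookup_back_append nth_default_Cons split: nat.split)

lemma ptime_nth_default [ptime_intros]:
  assumes "ptime l" "ptime i" shows "ptime (\<lambda>x. nth_default d (l x) (i x))"
  unfolding nth_default_conv_lookup_back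
proof (rule ptime_list_rec[where g = "lookup_back d" and a = "\<lambda>_. d" and
      s = "\<lambda>i y ys r. if i = length ys then y else r"])
  have "sz (lookup_back d i xs) \<le> sz d + sz xs" for i and xs :: "'b list"
    by (induction xs) auto
  then show "pbounded (\<lambda>z. sz (lookup_back d (fst z) (snd z)))"
    by (intro pbounded_mono[OF pbounded_add[OF pbounded_const[of "sz d"] pbounded_sz[OF ptime_snd[OF ptime_id]]]])
qed (intro ptime_intros assms | simp)+


lemma ptime_comp3:
  assumes "ptime (\<lambda>z. f (fst z) (fst (snd z)) (snd (snd z)))" "ptime u" "ptime v" "ptime w"
  shows "ptime (\<lambda>x. f (u x) (v x) (w x))"
  using ptime_comp[OF assms(1) ptime_pair[OF assms(2) ptime_pair[OF assms(3,4)]]] by simp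

subsection \<open>Binary arithmetic\<close>

fun val :: "bool list \<Rightarrow> nat" where
  "val [] = 0"
| "val (b # bs) = of_bool b + 2 * val bs"

lemma val_bits: "val (bits n) = n"
proof (induction n rule: bits.induct)
  case (1 n)
  then show ?case by (subst bits.simps) auto
qed

lemma val_take_Suc:
  "val (take (Suc n) xs) = val (take n xs) + 2 ^ n * of_bool (nth_default False xs n)"
proof (induction n arbitrary: xs)
  case 0
  then show ?case by (cases xs) auto
next
  case (Suc n)
  then show ?case by (cases xs) auto
qed

lemma val_less: "val xs < 2 ^ length xs"
  by (induction xs) auto

lemma val_take_less: "val (take n xs) < 2 ^ n"
  by (rule less_le_trans[OF val_less]) (simp add: power_increasing)

text \<open>Carries come from the low digits, whereas list recursion delivers the result for the
  high digits first. Recursion on the number of low positions has the carry at hand and reads both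
  summands in parallel, padded with \<open>False\<close>.\<close>

fun add_prefix :: "bool list \<times> bool list \<Rightarrow> nat \<Rightarrow> bool list \<times> bool" where
  "add_prefix p 0 = ([], False)"
| "add_prefix p (Suc n) =
    (let r = add_prefix p n; x = nth_default False (fst p) n; y = nth_default False (snd p) n; c = snd r
     in (fst r @ [x \<noteq> (y \<noteq> c)], x \<and> y \<or> x \<and> c \<or> y \<and> c))"

text \<open>With truncated subtraction the number of positions is the larger of the two lengths; the
  final carry becomes the top digit.\<close>

definition add_bits :: "bool list \<Rightarrow> bool list \<Rightarrow> bool list" where
  "add_bits xs ys =
    (let r = add_prefix (xs, ys) (length xs + (length ys - length xs)) in fst r @ [snd r])"

lemma val_append: "val (xs @ ys) = val xs + 2 ^ length xs * val ys"
  by (induction xs) (auto simp: algebra_simps)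

lemma length_add_prefix: "length (fst (add_prefix p n)) = n"
  by (induction n) (auto simp: Let_def)

lemma val_add_prefix:
  "val (fst (add_prefix (xs, ys) n)) + 2 ^ n * of_bool (snd (add_prefix (xs, ys) n)) =
    val (take n xs) + val (take n ys)"
proof (induction n)
  case (Suc n)
  have "val (fst (add_prefix (xs, ys) (Suc n))) +
      2 ^ Suc n * of_bool (snd (add_prefix (xs, ys) (Suc n))) =
      (val (fst (add_prefix (xs, ys) n)) + 2 ^ n * of_bool (snd (add_prefix (xs, ys) n))) +
      2 ^ n * of_bool (nth_default False xs n) + 2 ^ n * of_bool (nth_default False ys n)"
    by (cases "nth_default False xs n"; cases "nth_default False ys n";
        cases "snd (add_prefix (xs, ys) n)")
      (simp_all add: Let_def val_append length_add_prefix)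
  then show ?case unfolding Suc val_take_Suc by simp
qed simp

lemma val_add_bits: "val (add_bits xs ys) = val xs + val ys"
  using val_add_prefix[of xs ys "length xs + (length ys - length xs)"]
  by (simp add: add_bits_def Let_def val_append length_add_prefix)

lemma length_add_bits: "length (add_bits xs ys) = Suc (max (length xs) (length ys))"
  by (simp add: add_bits_def Let_def length_add_prefix)

lemma sz_bits_le: "sz (xs :: bool list) \<le> length xs * 2"
  using sz_list_le[of xs 1] sz_bool_le by simp

lemma ptime_add_bits [ptime_intros]:
  assumes "ptime f" "ptime g" shows "ptime (\<lambda>x. add_bits (f x) (g x))"
proof -
  have prefix: "ptime (\<lambda>x. add_prefix (p x) (n x))" if "ptime p" "ptime n" for p and n :: "'a \<Rightarrow> nat"
  proof (rule ptime_nat_rec[where g = add_prefix and a = "\<lambda>_. ([], False)" and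
      s = "\<lambda>p n r. let x = nth_default False (fst p) n; y = nth_default False (snd p) n; c = snd r
     in (fst r @ [x \<noteq> (y \<noteq> c)], x \<and> y \<or> x \<and> c \<or> y \<and> c)"])
    have "sz (add_prefix p n) \<le> n * 2 + 2" for p n
      using sz_bits_le[of "fst (add_prefix p n)"] sz_bool_le[of "snd (add_prefix p n)"]
      by (cases "add_prefix p n") (use length_add_prefix[of p n] in auto)
    moreover have "pbounded (\<lambda>z :: (bool list \<times> bool list) \<times> nat. sz (snd z) * 2 + 2)"
      by (intro pbounded_intros ptime_intros)
    ultimately show "pbounded (\<lambda>z. sz (add_prefix (fst z) (snd z)))"
      by (elim pbounded_mono) simp
  qed (simp, simp add: Let_def, (intro ptime_intros ptime_iff that)+)
  have plus: "ptime (\<lambda>x. m x + n x :: nat)" if "ptime m" "ptime n" for m n :: "'a \<Rightarrow> nat"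
    using ptime_length[OF ptime_append, of "\<lambda>x. replicate (m x) ()" "\<lambda>x. replicate (n x) ()"] that
    unfolding ptime_def by (simp add: enc_unary)
  show ?thesis
    unfolding add_bits_def by (intro ptime_intros prefix plus ptime_diff ptime_comp[OF assms(1)] ptime_comp[OF assms(2)] assms)
qed

fun mult_bits :: "bool list \<Rightarrow> bool list \<Rightarrow> bool list" where
  "mult_bits [] ys = []"
| "mult_bits (x # xs) ys = add_bits (if x then ys else []) (False # mult_bits xs ys)"

lemma val_mult_bits: "val (mult_bits xs ys) = val xs * val ys"
  by (induction xs) (auto simp: val_add_bits algebra_simps)

lemma length_mult_bits: "length (mult_bits xs ys) \<le> length ys + 2 * length xs"
  by (induction xs) (auto simp: length_add_bits)

lemma ptime_mult_bits [ptime_intros]: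
  assumes "ptime f" "ptime g" shows "ptime (\<lambda>x. mult_bits (f x) (g x))"
proof (rule ptime_list_rec[where g = "\<lambda>ys xs. mult_bits xs ys" and a = "\<lambda>_. []" and
      s = "\<lambda>ys x _ r. add_bits (if x then ys else []) (False # r)", OF _ _ _ _ _ assms(2,1)])
  have "sz (mult_bits xs ys) \<le> 2 * sz ys + 4 * sz xs" for xs ys
    using sz_bits_le[of "mult_bits xs ys"] length_mult_bits[of xs ys] length_le_sz[of xs] length_le_sz[of ys]
    by linarith
  moreover have "pbounded (\<lambda>z :: bool list \<times> bool list. 2 * sz (fst z) + 4 * sz (snd z))"
    by (intro pbounded_intros ptime_intros)
  ultimately show "pbounded (\<lambda>z. sz (mult_bits (snd z) (fst z)))"
    by (elim pbounded_mono) simp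
qed (intro ptime_intros | simp)+

text \<open>The highest differing digit decides. The total length used in \<open>le_bits\<close> is
  simply a number of positions that covers both inputs.\<close>

fun le_prefix :: "bool list \<times> bool list \<Rightarrow> nat \<Rightarrow> bool" where
  "le_prefix p 0 = True"
| "le_prefix p (Suc n) =
    (let x = nth_default False (fst p) n; y = nth_default False (snd p) n
     in if x \<longleftrightarrow> y then le_prefix p n else y)"

definition le_bits :: "bool list \<Rightarrow> bool list \<Rightarrow> bool" where
  "le_bits xs ys = le_prefix (xs, ys) (length (xs @ ys))"

lemma le_prefix: "le_prefix (xs, ys) n \<longleftrightarrow> val (take n xs) \<le> val (take n ys)"
proof (induction n)
  case (Suc n)
  then show ?case
    using val_take_less[of n xs] val_take_less[of n ys]
    unfolding val_take_Suc by (auto simp: Let_def)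
qed simp

lemma le_bits: "le_bits xs ys \<longleftrightarrow> val xs \<le> val ys"
  by (simp add: le_bits_def le_prefix)

lemma ptime_le_bits [ptime_intros]:
  assumes "ptime f" "ptime g" shows "ptime (\<lambda>x. le_bits (f x) (g x))"
  unfolding le_bits_def
proof (rule ptime_nat_rec[where g = le_prefix and a = "\<lambda>_. True" and
      s = "\<lambda>p n r. let x = nth_default False (fst p) n; y = nth_default False (snd p) n
     in if x \<longleftrightarrow> y then r else y"])
  show "pbounded (\<lambda>z. sz (le_prefix (fst z) (snd z)))"
    by (rule pbounded_mono[OF pbounded_const[of 1]]) (rule sz_bool_le)
qed (simp, simp add: Let_def, (intro ptime_intros ptime_iff assms)+)

section \<open>Arithmetic with unreduced fractions\<close>

type_synonym fraction = "bool list \<times> bool list"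

definition fraction_val :: "fraction \<Rightarrow> rat" where
  "fraction_val q = of_nat (val (fst q)) / of_nat (val (snd q))"

definition valid_fraction :: "fraction \<Rightarrow> bool" where
  "valid_fraction q \<longleftrightarrow> 0 < val (snd q)"

definition add_fraction :: "fraction \<Rightarrow> fraction \<Rightarrow> fraction" where
  "add_fraction p q =
    (add_bits (mult_bits (fst p) (snd q)) (mult_bits (snd p) (fst q)), mult_bits (snd p) (snd q))"

definition sum_fractions :: "fraction list \<Rightarrow> fraction" where
  "sum_fractions qs = foldr add_fraction qs ([], [True])"

definition le_fraction :: "fraction \<Rightarrow> fraction \<Rightarrow> bool" where
  "le_fraction p q = le_bits (mult_bits (fst p) (snd q)) (mult_bits (fst q) (snd p))"

lemma add_fraction:
  assumes "valid_fraction p" "valid_fraction q"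
  shows "valid_fraction (add_fraction p q)"
    "fraction_val (add_fraction p q) = fraction_val p + fraction_val q"
  using assms
  by (auto simp: valid_fraction_def add_fraction_def fraction_val_def val_add_bits val_mult_bits field_simps)

lemma sum_fractions:
  assumes "\<forall>q\<in>set qs. valid_fraction q"
  shows "valid_fraction (sum_fractions qs) \<and> fraction_val (sum_fractions qs) = sum_list (map fraction_val qs)"
  using assms
proof (induction qs)
  case Nil
  then show ?case by (simp add: sum_fractions_def valid_fraction_def fraction_val_def)
next
  case (Cons q qs)
  then show ?case using add_fraction[of q "sum_fractions qs"] by (simp add: sum_fractions_def)
qed

lemma le_fraction:
  assumes "valid_fraction p" "valid_fraction q"
  shows "le_fraction p q \<longleftrightarrow> fraction_val p \<le> fraction_val q"
proof -
  have "fraction_val p \<le> fraction_val q \<longleftrightarrow>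
      (of_nat (val (fst p) * val (snd q)) :: rat) \<le> of_nat (val (fst q) * val (snd p))"
    using assms by (simp add: valid_fraction_def fraction_val_def divide_simps)
  then show ?thesis
    unfolding of_nat_le_iff by (simp add: le_fraction_def le_bits val_mult_bits)
qed

lemma ptime_le_fraction [ptime_intros]:
  "ptime f \<Longrightarrow> ptime g \<Longrightarrow> ptime (\<lambda>x. le_fraction (f x) (g x))"
  unfolding le_fraction_def by (intro ptime_intros)

lemma ptime_add_fraction:
  "ptime f \<Longrightarrow> ptime g \<Longrightarrow> ptime (\<lambda>x. add_fraction (f x) (g x))"
  unfolding add_fraction_def by (intro ptime_intros)

text \<open>The bound stays linear without reducing fractions because in every product of
  \<open>add_fraction\<close> the accumulated factor stands second, where
  \<open>length_mult_bits\<close> has coefficient 1; the coefficient 2 falls only on the new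
  summand.\<close>

lemma length_sum_fractions:
  "length (fst (sum_fractions qs)) \<le> 2 * sz qs + 1 \<and> length (snd (sum_fractions qs)) \<le> 2 * sz qs + 1"
proof (induction qs)
  case (Cons q qs)
  obtain a b where q: "q = (a, b)" by (cases q)
  obtain c d where cd: "sum_fractions qs = (c, d)" by fastforce
  have "sum_fractions (q # qs) = (add_bits (mult_bits a d) (mult_bits b c), mult_bits b d)"
    using cd q by (simp add: sum_fractions_def add_fraction_def)
  then show ?case
    using Cons cd length_mult_bits[of a d] length_mult_bits[of b c] length_mult_bits[of b d]
      length_le_sz[of a] length_le_sz[of b]
    by (auto simp: q length_add_bits)
qed (simp add: sum_fractions_def)

lemma ptime_sum_fractions [ptime_intros]:
  assumes "ptime f" shows "ptime (\<lambda>x. sum_fractions (f x))"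
proof -
  have "sz (sum_fractions qs) \<le> 8 * sz qs + 5" for qs
    using length_sum_fractions[of qs] sz_bits_le[of "fst (sum_fractions qs)"]
      sz_bits_le[of "snd (sum_fractions qs)"]
    by (cases "sum_fractions qs") auto
  moreover have "pbounded (\<lambda>z :: 'a \<times> fraction list. 8 * sz (snd z) + 5)"
    by (intro pbounded_intros ptime_intros)
  ultimately have "pbounded (\<lambda>z :: 'a \<times> fraction list. sz (sum_fractions (snd z)))"
    by (elim pbounded_mono) simp
  then show ?thesis
    unfolding sum_fractions_def
    by (intro ptime_foldr ptime_intros ptime_add_fraction assms) (auto simp: sum_fractions_def)
qed

section \<open>Selecting a best candidate\<close>

definition best :: "('a \<Rightarrow> 'a \<Rightarrow> bool) \<Rightarrow> 'a \<Rightarrow> 'a list \<Rightarrow> 'a" where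
  "best le d xs = foldr (\<lambda>x b. if le b x then x else b) xs d"

lemma best_mem: "best le d xs \<in> insert d (set xs)"
  unfolding best_def by (induction xs) auto

text \<open>\<open>le\<close> has to compare weights correctly on the candidates only: comparing
  fractions is meaningful just for valid ones, and a list has the weight of its vertex set just if
  no vertex is repeated.\<close>

lemma best_ge:
  fixes w :: "'a \<Rightarrow> 'b :: linorder"
  assumes "\<And>x y. x \<in> insert d (set xs) \<Longrightarrow> y \<in> insert d (set xs) \<Longrightarrow> le x y \<longleftrightarrow> w x \<le> w y"
    and "y \<in> insert d (set xs)"
  shows "w y \<le> w (best le d xs)"
  using assms
proof (induction xs)
  case (Cons x xs)
  have b: "best le d xs \<in> insert d (set (x # xs))" using best_mem[of le d xs] by auto
  have IH: "w y \<le> w (best le d xs)" if "y \<in> insert d (set xs)"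
    using that Cons.prems(1) by (intro Cons.IH) auto
  have "best le d (x # xs) = (if w (best le d xs) \<le> w x then x else best le d xs)"
    using Cons.prems(1)[OF b, of x] by (simp add: best_def)
  moreover have "y = x \<or> y \<in> insert d (set xs)" using Cons.prems(2) by auto
  ultimately show ?case using IH by auto
qed (simp add: best_def)

lemma ptime_best:
  assumes le: "ptime (\<lambda>z. le (fst z) (fst (snd z)) (snd (snd z)))" and d: "ptime d" and l: "ptime l"
  shows "ptime (\<lambda>x. best (le x) (d x) (l x))"
  unfolding best_def
proof (rule ptime_foldr[OF _ l d])
  have "sz (best l d xs) \<le> sz d + sz xs" for l d and xs :: "'b list"
    using best_mem[of l d xs] sz_mem_le by fastforce
  moreover have "pbounded (\<lambda>z :: 'a \<times> 'b list. sz (d (fst z)) + sz (snd z))"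
    by (intro pbounded_intros ptime_comp[OF d] ptime_intros)
  ultimately show "pbounded (\<lambda>z. sz (foldr (\<lambda>x b. if le (fst z) b x then x else b) (snd z) (d (fst z))))"
    unfolding best_def by (elim pbounded_mono) simp
qed (intro ptime_intros ptime_comp3[OF le])


section \<open>Maximum-weight matchings by exchange\<close>

definition conflict :: "(nat \<Rightarrow> nat \<Rightarrow> bool) \<Rightarrow> nat \<times> nat \<Rightarrow> nat \<times> nat \<Rightarrow> bool" where
  "conflict adj p q \<longleftrightarrow> snd p = snd q \<and> adj (fst p) (fst q)"

text \<open>A state is a partial coloring (a list of vertex-color pairs) together with the at most one
  vertex that it fails to color.\<close>

type_synonym state = "nat list \<times> (nat \<times> nat) list"

text \<open>All pairs in conflict with \<open>e\<close> are evicted but only the first is recorded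
  as uncolored. If \<open>e\<close> gives the hole of a sound state an eligible color, there is at
  most one.\<close>

definition recolor :: "(nat \<Rightarrow> nat \<Rightarrow> bool) \<Rightarrow> (nat \<times> nat) list \<Rightarrow> nat \<times> nat \<Rightarrow> state" where
  "recolor adj P e =
    (case filter (conflict adj e) P of
       [] \<Rightarrow> ([], e # P)
     | q # _ \<Rightarrow> ([fst q], e # filter (\<lambda>p. \<not> conflict adj e p) P))"

definition successors ::
    "(nat \<Rightarrow> nat \<Rightarrow> bool) \<Rightarrow> (nat \<times> nat \<Rightarrow> bool) \<Rightarrow> nat list \<Rightarrow> state list \<Rightarrow> state list" where
  "successors adj elig cs T =
    concat (map (\<lambda>s. concat (map (\<lambda>u. map (\<lambda>c. recolor adj (snd s) (u, c))
      (filter (\<lambda>c. elig (u, c)) cs)) (fst s))) T)"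

text \<open>One state per hole suffices: in a sound state the hole determines the set of colored
  vertices and hence the weight.\<close>

definition insert_state :: "state \<Rightarrow> state list \<Rightarrow> state list" where
  "insert_state s T = (if \<exists>t\<in>set T. set (fst s) = set (fst t) then T else s # T)"

definition expand ::
    "(nat \<Rightarrow> nat \<Rightarrow> bool) \<Rightarrow> (nat \<times> nat \<Rightarrow> bool) \<Rightarrow> nat list \<Rightarrow> state list \<Rightarrow> state list" where
  "expand adj elig cs T = foldr insert_state (successors adj elig cs T) T"

definition reachable ::
    "(nat \<Rightarrow> nat \<Rightarrow> bool) \<Rightarrow> (nat \<times> nat \<Rightarrow> bool) \<Rightarrow> nat list \<Rightarrow> (nat \<times> nat) list \<Rightarrow> nat \<Rightarrow> nat \<Rightarrow> state list" where
  "reachable adj elig cs P v n = (expand adj elig cs ^^ n) [([v], P)]"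

text \<open>There are at most \<open>length P + 2\<close> holes, counting the empty one, so this
  many rounds make the set of holes closed under \<open>successors\<close>.\<close>

definition augment ::
    "(nat \<Rightarrow> nat \<Rightarrow> bool) \<Rightarrow> (nat \<times> nat \<Rightarrow> bool) \<Rightarrow> nat list \<Rightarrow>
      ((nat \<times> nat) list \<Rightarrow> (nat \<times> nat) list \<Rightarrow> bool) \<Rightarrow> (nat \<times> nat) list \<Rightarrow> nat \<Rightarrow> (nat \<times> nat) list" where
  "augment adj elig cs le P v =
    best le [] (map snd (reachable adj elig cs P v (Suc (Suc (length P)))))"

definition max_weight_coloring ::
    "(nat \<Rightarrow> nat \<Rightarrow> bool) \<Rightarrow> (nat \<times> nat \<Rightarrow> bool) \<Rightarrow> nat list \<Rightarrow>
      ((nat \<times> nat) list \<Rightarrow> (nat \<times> nat) list \<Rightarrow> bool) \<Rightarrow> nat list \<Rightarrow> (nat \<times> nat) list" where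
  "max_weight_coloring adj elig cs le vs = foldr (\<lambda>v P. augment adj elig cs le P v) vs []"

section \<open>Invariants and number of search states\<close>

lemma successors_mem:
  "t \<in> set (successors adj elig cs T) \<longleftrightarrow>
    (\<exists>s\<in>set T. \<exists>u\<in>set (fst s). \<exists>c\<in>set cs. elig (u, c) \<and> t = recolor adj (snd s) (u, c))"
  unfolding successors_def by auto

lemma foldr_insert_state_mem: "set T \<subseteq> set (foldr insert_state S T) \<and> set (foldr insert_state S T) \<subseteq> set S \<union> set T"
  by (induction S) (auto simp: insert_state_def)

lemma foldr_insert_state_distinct:
  "distinct (map (set \<circ> fst) T) \<Longrightarrow> distinct (map (set \<circ> fst) (foldr insert_state S T))"
  by (induction S) (auto simp: insert_state_def)

lemma recolor_cases:
  obtains (free) "\<forall>p\<in>set P. \<not> conflict adj e p" "recolor adj P e = ([], e # P)"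
  | (evict) q where "q \<in> set P" "conflict adj e q"
      "recolor adj P e = ([fst q], e # filter (\<lambda>p. \<not> conflict adj e p) P)"
proof (cases "filter (conflict adj e) P")
  case Nil
  then show ?thesis by (intro free) (auto simp: filter_empty_conv recolor_def)
next
  case (Cons q qs)
  then have "q \<in> set (filter (conflict adj e) P)" by simp
  then have "q \<in> set P" "conflict adj e q" by auto
  then show ?thesis by (intro evict[of q]) (auto simp: recolor_def Cons)
qed


text \<open>An invariant for arbitrary \<open>adj\<close> and \<open>elig\<close>, used for sizes
  and counting, since inputs whose conflicts form no cliques have to be bounded as well. The total
  length cannot grow: a recolored hole either disappears or is replaced while at least one pair is
  evicted.\<close>

definition bounded_state :: "nat set \<Rightarrow> nat set \<Rightarrow> nat \<Rightarrow> state \<Rightarrow> bool" where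
  "bounded_state U C n s \<longleftrightarrow>
    (fst s = [] \<or> (\<exists>u\<in>U. fst s = [u])) \<and> length (fst s) + length (snd s) \<le> n \<and>
    set (snd s) \<subseteq> U \<times> C"

lemma bounded_state_recolor:
  assumes "bounded_state U C n s" "u \<in> set (fst s)" "c \<in> C"
  shows "bounded_state U C n (recolor adj (snd s) (u, c))"
proof -
  from assms have s: "fst s = [u]" "u \<in> U" "Suc (length (snd s)) \<le> n" "set (snd s) \<subseteq> U \<times> C"
    by (auto simp: bounded_state_def)
  show ?thesis
  proof (cases rule: recolor_cases[of "snd s" adj "(u, c)"])
    case free
    with s assms(3) show ?thesis by (auto simp: bounded_state_def)
  next
    case (evict q)
    have "length (filter (\<lambda>p. \<not> conflict adj (u, c) p) (snd s)) < length (snd s)"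
      using evict(1,2) by (intro length_filter_less[of q]) auto
    with evict s assms(3) show ?thesis by (auto simp: bounded_state_def)
  qed
qed

lemma bounded_state_expand:
  assumes "\<forall>s\<in>set T. bounded_state U C n s" "set cs \<subseteq> C"
  shows "\<forall>s\<in>set (expand adj elig cs T). bounded_state U C n s"
proof
  fix s assume "s \<in> set (expand adj elig cs T)"
  then consider "s \<in> set T" | "s \<in> set (successors adj elig cs T)"
    using foldr_insert_state_mem[of T "successors adj elig cs T"] by (auto simp: expand_def)
  then show "bounded_state U C n s"
  proof cases
    case 2
    then obtain t u c where "t \<in> set T" "u \<in> set (fst t)" "c \<in> set cs"
      "s = recolor adj (snd t) (u, c)" unfolding successors_mem by blast
    with assms show ?thesis using bounded_state_recolor[of U C n t u c adj] by auto
  qed (use assms in blast)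
qed

lemma bounded_state_reachable:
  assumes "s \<in> set (reachable adj elig cs P v n)"
  shows "bounded_state (insert v (fst ` set P)) (set cs \<union> snd ` set P) (Suc (length P)) s"
proof -
  have "\<forall>s\<in>set (reachable adj elig cs P v n).
      bounded_state (insert v (fst ` set P)) (set cs \<union> snd ` set P) (Suc (length P)) s"
  proof (induction n)
    case 0
    then show ?case by (force simp: reachable_def bounded_state_def)
  next
    case (Suc n)
    then show ?case
      using bounded_state_expand[OF Suc, of cs adj elig] by (simp add: reachable_def)
  qed
  with assms show ?thesis by blast
qed

lemma distinct_reachable: "distinct (map (set \<circ> fst) (reachable adj elig cs P v n))"
proof (induction n)
  case (Suc n)
  then show ?case
    using foldr_insert_state_distinct[OF Suc] by (simp add: reachable_def expand_def comp_def)
qed (simp add: reachable_def)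

text \<open>The stored holes are pairwise different, and each of them is empty, \<open>v\<close> or
  a vertex of \<open>P\<close>.\<close>

lemma length_reachable_le: "length (reachable adj elig cs P v n) \<le> length P + 2"
proof -
  let ?T = "reachable adj elig cs P v n" and ?U = "insert v (fst ` set P)"
  have "set (fst s) \<in> insert {} ((\<lambda>u. {u}) ` ?U)" if "s \<in> set ?T" for s
  proof -
    have "fst s = [] \<or> (\<exists>u\<in>?U. fst s = [u])"
      using bounded_state_reachable[OF that] unfolding bounded_state_def by blast
    then show ?thesis by (elim disjE bexE) (simp_all only: list.set, blast+)
  qed
  then have "set (map (set \<circ> fst) ?T) \<subseteq> insert {} ((\<lambda>u. {u}) ` ?U)" by auto
  then have "card (set (map (set \<circ> fst) ?T)) \<le> card (insert {} ((\<lambda>u. {u}) ` ?U))"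
    by (intro card_mono) auto
  also have "\<dots> \<le> Suc (card ?U)"
    by (rule card_insert_le_m1) (simp_all del: image_insert add: card_image_le)
  also have "\<dots> \<le> length P + 2"
    using card_insert_le_m1[of "Suc (length P)" "fst ` set P" v]
      le_trans[OF card_image_le[of "set P" fst] card_length[of P]] by simp
  finally show ?thesis
    using distinct_card[OF distinct_reachable[of adj elig cs P v n]] by simp
qed

lemma augment_mem:
  "augment adj elig cs le P v = [] \<or>
    (\<exists>s\<in>set (reachable adj elig cs P v (Suc (Suc (length P)))). augment adj elig cs le P v = snd s)"
  using best_mem[of le "[]" "map snd (reachable adj elig cs P v (Suc (Suc (length P))))"]
  by (auto simp: augment_def)

lemma augment_bounded:
  "length (augment adj elig cs le P v) \<le> Suc (length P) \<and>
    set (augment adj elig cs le P v) \<subseteq> insert v (fst ` set P) \<times> (set cs \<union> snd ` set P)"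
  using augment_mem[of adj elig cs le P v]
proof
  assume "\<exists>s\<in>set (reachable adj elig cs P v (Suc (Suc (length P)))). augment adj elig cs le P v = snd s"
  then obtain s where s: "s \<in> set (reachable adj elig cs P v (Suc (Suc (length P))))"
    "augment adj elig cs le P v = snd s" by blast
  from bounded_state_reachable[OF s(1)] show ?thesis by (auto simp: bounded_state_def s(2))
qed simp

lemma max_weight_coloring_bounded:
  "length (max_weight_coloring adj elig cs le vs) \<le> length vs \<and>
    set (max_weight_coloring adj elig cs le vs) \<subseteq> set vs \<times> set cs"
proof (induction vs)
  case (Cons v vs)
  let ?P = "max_weight_coloring adj elig cs le vs"
  have "length (augment adj elig cs le ?P v) \<le> Suc (length vs)"
    using Cons augment_bounded[of adj elig cs le ?P v] by simp
  moreover have "set (augment adj elig cs le ?P v) \<subseteq> set (v # vs) \<times> set cs"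
    using Cons augment_bounded[of adj elig cs le ?P v] by fastforce
  ultimately show ?case by (simp add: max_weight_coloring_def)
qed (simp add: max_weight_coloring_def)

lemma sz_bounded_state:
  assumes s: "bounded_state U C n s" and b: "\<And>u. u \<in> U \<Longrightarrow> u \<le> m" "\<And>c. c \<in> C \<Longrightarrow> c \<le> m"
  shows "sz s \<le> Suc (Suc (m + n * Suc (Suc (m + m))))"
proof -
  obtain h Q where hQ: "s = (h, Q)" by (cases s)
  have "sz e \<le> Suc (m + m)" if "e \<in> set Q" for e
  proof -
    have "fst e \<in> U" "snd e \<in> C" using that s by (auto simp: bounded_state_def hQ)
    then show ?thesis using b[of "fst e"] b(2)[of "snd e"] by (simp add: enc_prod)
  qed
  then have "sz Q \<le> length Q * Suc (Suc (m + m))" by (rule sz_list_le)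
  also have "\<dots> \<le> n * Suc (Suc (m + m))"
    using s by (intro mult_le_mono1) (simp add: bounded_state_def hQ)
  finally have "sz Q \<le> n * Suc (Suc (m + m))" .
  moreover have "sz h \<le> Suc m"
    using s b by (auto simp: bounded_state_def hQ)
  ultimately show ?thesis by (simp add: hQ)
qed

section \<open>Running time of the matching algorithm\<close>

lemma ptime_set_eq [ptime_intros]:
  assumes "ptime f" "ptime g" shows "ptime (\<lambda>x. set (f x) = (set (g x) :: nat set))"
proof -
  have "ptime (\<lambda>x. (\<forall>y\<in>set (f x). y \<in> set (g x)) \<and> (\<forall>y\<in>set (g x). y \<in> set (f x)))"
    by (intro ptime_intros assms ptime_comp[OF assms(1)] ptime_comp[OF assms(2)])
  then show ?thesis by (rule back_subst[where P = ptime]) auto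
qed

lemma ptime_conflict:
  assumes "ptime (\<lambda>z. adj (fst z) (fst (snd z)) (snd (snd z)))" "ptime a" "ptime p" "ptime q"
  shows "ptime (\<lambda>x. conflict (adj (a x)) (p x) (q x))"
  unfolding conflict_def by (intro ptime_intros ptime_comp3[OF assms(1)] assms(2-))

lemma ptime_recolor:
  assumes adj: "ptime (\<lambda>z. adj (fst z) (fst (snd z)) (snd (snd z)))"
    and "ptime a" "ptime P" "ptime e"
  shows "ptime (\<lambda>x. recolor (adj (a x)) (P x) (e x))"
  unfolding recolor_def
  by (intro ptime_intros ptime_conflict[OF adj] assms(2-) assms(2-)[THEN ptime_comp])

lemma ptime_successors:
  assumes adj: "ptime (\<lambda>z. adj (fst z) (fst (snd z)) (snd (snd z)))"
    and elig: "ptime (\<lambda>z. elig (fst z) (snd z))" and "ptime a" "ptime b" "ptime T"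
  shows "ptime (\<lambda>x. successors (adj (a x)) (elig (b x)) cs (T x))"
  unfolding successors_def
  by (intro ptime_intros ptime_recolor[OF adj] ptime_comp2[OF elig] assms(3-) assms(3-)[THEN ptime_comp])

lemma ptime_insert_state:
  assumes "ptime s" "ptime T" shows "ptime (\<lambda>x. insert_state (s x) (T x))"
  unfolding insert_state_def
  by (intro ptime_intros assms assms[THEN ptime_comp])

lemma ptime_expand:
  fixes T :: "'a::encodable \<Rightarrow> state list"
  assumes adj: "ptime (\<lambda>z. adj (fst z) (fst (snd z)) (snd (snd z)))"
    and elig: "ptime (\<lambda>z. elig (fst z) (snd z))" and ab: "ptime a" "ptime b" "ptime T"
  shows "ptime (\<lambda>x. expand (adj (a x)) (elig (b x)) cs (T x))"
  unfolding expand_def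
proof (rule ptime_foldr)
  have "sz (foldr insert_state S T) \<le> sz S + sz T" for S T
    by (induction S) (auto simp: insert_state_def)
  moreover have "pbounded (\<lambda>z :: 'a \<times> state list. sz (snd z) + sz (T (fst z)))"
    by (intro pbounded_intros ptime_intros ab(3)[THEN ptime_comp])
  ultimately show "pbounded (\<lambda>z. sz (foldr insert_state (snd z) (T (fst z))))"
    by (elim pbounded_mono) simp
qed (intro ptime_intros ptime_insert_state ptime_successors[OF adj elig] ab)+

lemma ptime_reachable:
  assumes adj: "ptime (\<lambda>z. adj (fst z) (fst (snd z)) (snd (snd z)))"
    and elig: "ptime (\<lambda>z. elig (fst z) (snd z))"
    and P: "ptime P" and v: "ptime v" and n: "ptime n"
  shows "ptime (\<lambda>x. reachable (adj x) (elig x) cs (P x) (v x) (n x))"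
  unfolding reachable_def
proof (rule ptime_funpow)
  \<comment> \<open>\<open>m\<close> bounds every vertex and color that can occur, as a unary number
    is its own size; \<open>s\<close> bounds the size of one state, and
    \<open>length_reachable_le\<close> the number of states.\<close>
  define m where "m z = sz (P (fst z)) + (sz (v (fst z)) + sz cs)" for z :: "'a \<times> nat"
  define s where "s z = Suc (Suc (m z + Suc (sz (P (fst z))) * Suc (Suc (m z + m z))))"
    for z :: "'a \<times> nat"
  have "sz (reachable (adj (fst z)) (elig (fst z)) cs (P (fst z)) (v (fst z)) (snd z)) \<le>
      (sz (P (fst z)) + 2) * Suc (s z)" for z
  proof -
    let ?P = "P (fst z)" and ?v = "v (fst z)"
    let ?T = "reachable (adj (fst z)) (elig (fst z)) cs ?P ?v (snd z)"
    have mem: "fst p \<le> sz ?P" "snd p \<le> sz ?P" if "p \<in> set ?P" for p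
      using sz_mem_le[OF that] by (cases p; simp)+
    have "sz t \<le> s z" if t: "t \<in> set ?T" for t
    proof -
      have "sz t \<le> Suc (Suc (m z + Suc (length ?P) * Suc (Suc (m z + m z))))"
        by (rule sz_bounded_state[OF bounded_state_reachable[OF t]])
          (use mem sz_mem_le[of _ cs] in \<open>force simp: m_def\<close>)+
      also have "\<dots> \<le> s z"
        unfolding s_def using length_le_sz[of ?P] by (intro Suc_leI le_imp_less_Suc add_mono mult_le_mono) auto
      finally show ?thesis .
    qed
    then have "sz ?T \<le> length ?T * Suc (s z)" by (rule sz_list_le)
    also have "\<dots> \<le> (sz ?P + 2) * Suc (s z)"
      using length_reachable_le[of "adj (fst z)" "elig (fst z)" cs ?P ?v "snd z"] length_le_sz[of ?P]
      by (intro mult_le_mono1) simp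
    finally show ?thesis .
  qed
  moreover have "pbounded (\<lambda>z. (sz (P (fst z)) + 2) * Suc (s z))"
    unfolding s_def m_def by (intro pbounded_intros ptime_intros P[THEN ptime_comp] v[THEN ptime_comp])
  ultimately show "pbounded (\<lambda>z. sz ((expand (adj (fst z)) (elig (fst z)) cs ^^ snd z) [([v (fst z)], P (fst z))]))"
    unfolding reachable_def by (elim pbounded_mono) simp
qed (intro ptime_intros ptime_expand[OF adj elig] P v n)+

lemma ptime_augment:
  assumes adj: "ptime (\<lambda>z. adj (fst z) (fst (snd z)) (snd (snd z)))"
    and elig: "ptime (\<lambda>z. elig (fst z) (snd z))"
    and le: "ptime (\<lambda>z. le (fst z) (fst (snd z)) (snd (snd z)))"
    and P: "ptime P" and v: "ptime v"
  shows "ptime (\<lambda>x. augment (adj x) (elig x) cs (le x) (P x) (v x))"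
  unfolding augment_def
  by (intro ptime_best le ptime_intros ptime_reachable adj elig P v)

lemma ptime_max_weight_coloring:
  assumes adj: "ptime (\<lambda>z. adj (fst z) (fst (snd z)) (snd (snd z)))"
    and elig: "ptime (\<lambda>z. elig (fst z) (snd z))"
    and le: "ptime (\<lambda>z. le (fst z) (fst (snd z)) (snd (snd z)))"
    and vs: "ptime vs"
  shows "ptime (\<lambda>x. max_weight_coloring (adj x) (elig x) cs (le x) (vs x))"
  unfolding max_weight_coloring_def
proof (rule ptime_foldr[OF _ vs])
  have "sz (max_weight_coloring adj elig cs le l) \<le> sz l * Suc (Suc (sz l + sz cs))" for adj elig le l
  proof -
    let ?P = "max_weight_coloring adj elig cs le l"
    have "sz e \<le> Suc (sz l + sz cs)" if "e \<in> set ?P" for e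
    proof -
      have "fst e \<in> set l" "snd e \<in> set cs"
        using that max_weight_coloring_bounded[of adj elig cs le l] by auto
      then show ?thesis
        using sz_mem_le[of "fst e" l] sz_mem_le[of "snd e" cs] by (simp add: enc_prod)
    qed
    then have "sz ?P \<le> length ?P * Suc (Suc (sz l + sz cs))" by (rule sz_list_le)
    also have "\<dots> \<le> sz l * Suc (Suc (sz l + sz cs))"
      using max_weight_coloring_bounded[of adj elig cs le l] length_le_sz[of l] by (intro mult_le_mono1) simp
    finally show ?thesis .
  qed
  moreover have "pbounded (\<lambda>z :: 'a \<times> nat list. sz (snd z) * Suc (Suc (sz (snd z) + sz cs)))"
    by (intro pbounded_intros ptime_intros)
  ultimately show "pbounded (\<lambda>z. sz (foldr (\<lambda>v P. augment (adj (fst z)) (elig (fst z)) cs (le (fst z)) P v) (snd z) []))"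
    unfolding max_weight_coloring_def by (elim pbounded_mono) simp
  show "ptime (\<lambda>z. augment (adj (fst z)) (elig (fst z)) cs (le (fst z)) (snd (snd z)) (fst (snd z)))"
    by (intro ptime_augment ptime_intros ptime_comp3[OF adj] ptime_comp2[OF elig] ptime_comp3[OF le])
qed (rule ptime_const)


text \<open>A matching in the bipartite graph in which \<open>e\<close> joins the vertex
  \<open>fst e\<close> to the block \<open>b e\<close>.\<close>

definition matching :: "('v \<times> 'c) set \<Rightarrow> ('v \<times> 'c \<Rightarrow> 'b) \<Rightarrow> ('v \<times> 'c) set \<Rightarrow> bool" where
  "matching El b P \<longleftrightarrow> P \<subseteq> El \<and> finite P \<and> inj_on fst P \<and> inj_on b P"

text \<open>The hypothesis \<open>tight\<close> says that every block meeting \<open>H\<close> is used in \<open>P\<close> by a vertex of \<open>H\<close>.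
  An alternating path that starts with a free block therefore runs inside \<open>H\<close>, and each of its
  steps makes \<open>Y\<close> agree with \<open>P\<close> on one more edge.\<close>

lemma alternating_path:
  assumes P: "matching El b P" and Y: "matching El b Y"
    and tight: "\<And>e. e \<in> El \<Longrightarrow> fst e \<in> H \<Longrightarrow> \<exists>p\<in>P. b p = b e \<and> fst p \<in> H"
    and e: "e \<in> El" "fst e \<in> H" "b e \<notin> b ` Y"
  shows "\<exists>u\<in>H \<inter> fst ` P. u \<notin> fst ` Y \<and> (\<exists>Z. matching El b Z \<and> fst ` Z = insert u (fst ` Y))"
  using Y e
proof (induction "card (P - Y)" arbitrary: Y e rule: less_induct)
  case less
  obtain p where p: "p \<in> P" "b p = b e" "fst p \<in> H" using tight less.prems(2,3) by blast
  have "b p \<notin> b ` Y" using less.prems(4) p(2) by simp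
  then have pY: "b p \<notin> b ` Y" "p \<notin> Y" by auto
  have pE: "p \<in> El" and fP: "finite P" and injP: "inj_on fst P" using P p(1) by (auto simp: matching_def)
  show ?case
  proof (cases "fst p \<in> fst ` Y")
    case False
    then have "matching El b (insert p Y)"
      using less.prems(1) pE pY by (auto simp: matching_def)
    then show ?thesis using p False by (intro bexI[of _ "fst p"]) auto
  next
    case True
    then obtain y where y: "y \<in> Y" "fst y = fst p" by force
    let ?Y = "insert p (Y - {y})"
    have inj: "inj_on fst Y" "inj_on b Y" using less.prems(1) by (auto simp: matching_def)
    have "fst p \<notin> fst ` (Y - {y})"
      using inj(1) y by (auto simp: inj_on_def)
    then have M: "matching El b ?Y"
      using less.prems(1) pE pY inj by (auto simp: matching_def inj_on_diff)
    have "fst ` ?Y = insert (fst y) (fst ` (Y - {y}))" by (simp add: y(2))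
    also have "\<dots> = fst ` Y" using y(1) by (metis image_insert insert_Diff)
    finally have img: "fst ` ?Y = fst ` Y" .
    have "y \<notin> P" using injP p(1) y pY(2) by (auto simp: inj_on_def)
    then have "P - ?Y \<subset> P - Y" using p(1) pY(2) by auto
    then have lt: "card (P - ?Y) < card (P - Y)" using fP by (intro psubset_card_mono) auto
    have "b y \<noteq> b p" using pY(1) y(1) by (metis imageI)
    moreover have "b y \<notin> b ` (Y - {y})" using inj(2) y(1) by (auto simp: inj_on_def)
    ultimately have by': "b y \<notin> b ` ?Y" by simp
    have "y \<in> El" "fst y \<in> H" using less.prems(1) y p(3) by (auto simp: matching_def)
    from less.hyps[OF lt M this by'] show ?thesis unfolding img .
  qed
qed

text \<open>Let \<open>X\<close> use \<open>v\<close>, and let \<open>Y\<close> be \<open>X\<close>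
  without its edge at \<open>v\<close>. If the empty hole occurs, \<open>v\<close> joins
  \<open>P\<close> at no loss, and \<open>Y\<close> weighs no more than \<open>P\<close>. Otherwise
  an alternating path from the block released by \<open>X\<close> gives a hole \<open>u\<close> in
  \<open>P\<close> such that the vertices of \<open>Y\<close> together with \<open>u\<close> can be
  matched inside \<open>V\<close>. So \<open>Y\<close> weighs at most \<open>P\<close> minus
  \<open>u\<close>, and the state with hole \<open>u\<close> weighs at least as much as
  \<open>X\<close>.\<close>

lemma exchange_optimal:
  fixes \<omega> :: "'v \<Rightarrow> rat" and T :: "('v set \<times> ('v \<times> 'c) set) set"
  assumes P: "matching El b P" "fst ` P \<subseteq> V" and v: "v \<notin> V"
    and opt: "\<And>X. matching El b X \<Longrightarrow> fst ` X \<subseteq> V \<Longrightarrow> sum \<omega> (fst ` X) \<le> sum \<omega> (fst ` P)"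
    and start: "({v}, P) \<in> T"
    and T: "\<And>h Q. (h, Q) \<in> T \<Longrightarrow> matching El b Q \<and> fst ` Q = insert v (fst ` P) - h"
    and hole: "\<And>h Q. (h, Q) \<in> T \<Longrightarrow> h = {} \<or> (\<exists>u\<in>insert v (fst ` P). h = {u}) \<and> b ` Q = b ` P"
    and local: "\<And>h Q e. (h, Q) \<in> T \<Longrightarrow> e \<in> P \<union> Q \<Longrightarrow> e \<notin> P \<inter> Q \<Longrightarrow> fst e \<in> \<Union> (fst ` T)"
    and closed: "\<And>h Q e. (h, Q) \<in> T \<Longrightarrow> e \<in> El \<Longrightarrow> fst e \<in> h \<Longrightarrow>
      {} \<in> fst ` T \<or> (\<exists>q\<in>Q. b q = b e \<and> {fst q} \<in> fst ` T)"
    and X: "matching El b X" "fst ` X \<subseteq> insert v V"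
  shows "\<exists>(h, Q)\<in>T. sum \<omega> (fst ` X) \<le> sum \<omega> (fst ` Q)"
proof (cases "v \<in> fst ` X")
  case False
  then have "sum \<omega> (fst ` X) \<le> sum \<omega> (fst ` P)" using X by (intro opt) auto
  with start show ?thesis by auto
next
  case True
  then obtain x where x: "x \<in> X" "fst x = v" by auto
  let ?Y = "X - {x}" and ?H = "\<Union> (fst ` T)"
  have injX: "inj_on fst X" "inj_on b X" and finX: "finite X" using X by (auto simp: matching_def)
  have Y: "matching El b ?Y" using X(1) by (auto simp: matching_def inj_on_diff)
  have imgY: "fst ` ?Y = fst ` X - {v}" using injX x by (auto simp: inj_on_def)
  have vP: "v \<notin> fst ` P" using P(2) v by auto
  have finP: "finite (fst ` P)" using P by (auto simp: matching_def)
  have sumX: "sum \<omega> (fst ` X) = \<omega> v + sum \<omega> (fst ` ?Y)"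
    unfolding imgY using True finX by (simp add: sum.remove)
  have sumP: "sum \<omega> (insert v (fst ` P)) = \<omega> v + sum \<omega> (fst ` P)" using vP finP by simp
  show ?thesis
  proof (cases "{} \<in> fst ` T")
    case True
    then obtain Q where Q: "({}, Q) \<in> T" by auto
    have "sum \<omega> (fst ` ?Y) \<le> sum \<omega> (fst ` P)" using Y X(2) imgY by (intro opt) auto
    with T[OF Q] sumX sumP Q show ?thesis by (intro bexI[of _ "({}, Q)"]) simp_all
  next
    case False
    have tight: "\<exists>p\<in>P. b p = b e \<and> fst p \<in> ?H" if e: "e \<in> El" "fst e \<in> ?H" for e
    proof -
      obtain h Q where hQ: "(h, Q) \<in> T" "fst e \<in> h" using e(2) by auto
      then obtain q where q: "q \<in> Q" "b q = b e" "{fst q} \<in> fst ` T"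
        using closed[OF hQ(1) e(1) hQ(2)] False by blast
      have qH: "fst q \<in> ?H" using q(3) by auto
      \<comment> \<open>\<open>tight\<close> asks for an edge of \<open>P\<close>, while closure
        supplies \<open>q\<close> in \<open>Q\<close>. Both matchings use the same blocks, and an
        edge of \<open>P\<close> missing from \<open>Q\<close> sits at a vertex that is itself a
        hole.\<close>
      have "b ` Q = b ` P" using hole[OF hQ(1)] hQ(2) by auto
      then obtain p where p: "p \<in> P" "b p = b q" using q(1) by (metis imageE imageI)
      show ?thesis
      proof (cases "p \<in> Q")
        case True
        then have "p = q" using T[OF hQ(1)] q(1) p(2) by (auto simp: matching_def inj_on_def)
        then show ?thesis using p q qH by auto
      next
        case False
        then have "fst p \<in> ?H" using local[OF hQ(1), of p] p(1) by auto
        then show ?thesis using p q by auto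
      qed
    qed
    have "fst x \<in> ?H" using start x by force
    moreover have "b x \<notin> b ` ?Y" using injX(2) x by (auto simp: inj_on_def)
    moreover have "x \<in> El" using X(1) x by (auto simp: matching_def)
    ultimately obtain u Z where u: "u \<in> ?H" "u \<in> fst ` P" "u \<notin> fst ` ?Y"
      and Z: "matching El b Z" "fst ` Z = insert u (fst ` ?Y)"
      using alternating_path[OF P(1) Y tight, of x] by blast
    obtain h Q where hQ: "(h, Q) \<in> T" "u \<in> h" using u(1) by auto
    have "fst ` Q = insert v (fst ` P) - {u}"
      using T[OF hQ(1)] hole[OF hQ(1)] hQ(2) by auto
    then have sumQ: "sum \<omega> (fst ` Q) + \<omega> u = \<omega> v + sum \<omega> (fst ` P)"
      using sumP finP u(2) by (simp add: sum.remove[of "insert v (fst ` P)" u])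
    have "sum \<omega> (fst ` Z) \<le> sum \<omega> (fst ` P)"
      using Z X(2) imgY u(2) P(2) by (intro opt) auto
    moreover have "sum \<omega> (fst ` Z) = \<omega> u + sum \<omega> (fst ` ?Y)"
      unfolding Z(2) using u(3) finX by (intro sum.insert) auto
    ultimately show ?thesis using sumX sumQ hQ(1) by (intro bexI[of _ "(h, Q)"]) auto
  qed
qed

section \<open>Saturation of the search and optimality of its result\<close>

lemma foldr_insert_state_append:
  "\<exists>xs. foldr insert_state S T = xs @ T"
  by (induction S) (auto simp: insert_state_def)

lemma foldr_insert_state_closed:
  "s \<in> set S \<Longrightarrow> \<exists>t\<in>set (foldr insert_state S T). set (fst s) = set (fst t)"
  by (induction S) (auto simp: insert_state_def)

lemma foldr_insert_state_idle:
  "(\<And>s. s \<in> set S \<Longrightarrow> \<exists>t\<in>set T. set (fst s) = set (fst t)) \<Longrightarrow> foldr insert_state S T = T"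
  by (induction S) (auto simp: insert_state_def)

text \<open>Pigeonhole: every round before saturation adds a state, and a saturated search stays
  saturated. Without saturation after \<open>length P + 2\<close> rounds there would be more states
  than \<open>length_reachable_le\<close> allows.\<close>

lemma reachable_closed:
  assumes "s \<in> set (successors adj elig cs (reachable adj elig cs P v (Suc (Suc (length P)))))"
  shows "\<exists>t\<in>set (reachable adj elig cs P v (Suc (Suc (length P)))). set (fst s) = set (fst t)"
proof -
  let ?T = "reachable adj elig cs P v" and ?S = "\<lambda>n. successors adj elig cs (reachable adj elig cs P v n)"
  have "(\<forall>s\<in>set (?S n). \<exists>t\<in>set (?T n). set (fst s) = set (fst t)) \<or> Suc n \<le> length (?T n)" for n
  proof (induction n)
    case 0
    then show ?case by (simp add: reachable_def)
  next
    case (Suc n)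
    have step: "?T (Suc n) = foldr insert_state (?S n) (?T n)"
      by (simp add: reachable_def expand_def)
    obtain xs where xs: "?T (Suc n) = xs @ ?T n"
      using foldr_insert_state_append unfolding step by blast
    show ?case
    proof (cases "xs = []")
      case True
      then have "?T (Suc n) = ?T n" using xs by simp
      moreover have "\<forall>s\<in>set (?S n). \<exists>t\<in>set (?T (Suc n)). set (fst s) = set (fst t)"
        unfolding step using foldr_insert_state_closed by blast
      ultimately show ?thesis by simp
    next
      case False
      show ?thesis
      proof (cases "Suc n \<le> length (?T n)")
        case True
        with False show ?thesis unfolding xs by (cases xs) auto
      next
        case closed: False
        then have "?T (Suc n) = ?T n" unfolding step using Suc by (intro foldr_insert_state_idle) auto
        with xs False show ?thesis by simp
      qed
    qed
  qed
  from this[of "Suc (Suc (length P))"] show ?thesis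
    using length_reachable_le[of adj elig cs P v "Suc (Suc (length P))"] assms by auto
qed

text \<open>Here \<open>H\<close> is the set of all holes: a state differs from \<open>P\<close> only at vertices that are themselves
  holes.\<close>

definition sound_state ::
    "(nat \<times> nat) set \<Rightarrow> (nat \<times> nat \<Rightarrow> 'b) \<Rightarrow> (nat \<times> nat) set \<Rightarrow> nat \<Rightarrow> nat set \<Rightarrow> state \<Rightarrow> bool" where
  "sound_state El b P v H s \<longleftrightarrow>
     distinct (snd s) \<and> matching El b (set (snd s)) \<and> fst ` set (snd s) = insert v (fst ` P) - set (fst s) \<and>
     (fst s = [] \<or> (\<exists>u\<in>insert v (fst ` P). fst s = [u]) \<and> b ` set (snd s) = b ` P) \<and>
     (\<forall>e\<in>P \<union> set (snd s). e \<in> P \<inter> set (snd s) \<or> fst e \<in> H)"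

lemma sound_state_mono:
  "sound_state El b P v H s \<Longrightarrow> H \<subseteq> H' \<Longrightarrow> sound_state El b P v H' s"
  unfolding sound_state_def by blast

text \<open>\<open>b\<close> exists only for the analysis, as the algorithm tests nothing but
  \<open>conflict\<close>. The vertices have to differ because an edge shares its block with itself,
  while for an irreflexive \<open>adj\<close> it is not in conflict with itself.\<close>

locale coloring_blocks =
  fixes adj :: "nat \<Rightarrow> nat \<Rightarrow> bool" and elig :: "nat \<times> nat \<Rightarrow> bool" and cs :: "nat list"
    and b :: "nat \<times> nat \<Rightarrow> 'b"
  assumes block: "\<And>e e'. elig e \<Longrightarrow> elig e' \<Longrightarrow> fst e \<noteq> fst e' \<Longrightarrow> b e = b e' \<longleftrightarrow> conflict adj e e'"
begin

definition "El = {e. elig e \<and> snd e \<in> set cs}"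

text \<open>The hole \<open>u\<close> is uncolored, so every pair of the state has another vertex
  and \<open>block\<close> applies: being in conflict with \<open>(u, c)\<close> means lying in its
  block. A matching has at most one such pair, which is traded for \<open>(u, c)\<close> without
  changing the set of used blocks.\<close>

lemma sound_state_recolor:
  assumes s: "sound_state El b P v H s" and u: "u \<in> set (fst s)" "u \<in> H" and c: "(u, c) \<in> El"
  shows "sound_state El b P v (H \<union> set (fst (recolor adj (snd s) (u, c)))) (recolor adj (snd s) (u, c))"
    and "fst (recolor adj (snd s) (u, c)) \<noteq> [] \<Longrightarrow>
      \<exists>q\<in>set (snd s). b q = b (u, c) \<and> fst (recolor adj (snd s) (u, c)) = [fst q]"
proof -
  let ?t = "recolor adj (snd s) (u, c)"
  let ?Q = "set (snd s)" and ?e = "(u, c)"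
  have "fst s = [] \<or> (\<exists>w\<in>insert v (fst ` P). fst s = [w]) \<and> b ` ?Q = b ` P"
    using s unfolding sound_state_def by blast
  with u(1) obtain w where w: "w \<in> insert v (fst ` P)" "fst s = [w]" and bQ: "b ` ?Q = b ` P"
    by (metis empty_iff list.set(1))
  have "w = u" using u(1) w(2) by simp
  with w have h: "fst s = [u]" "u \<in> insert v (fst ` P)" by simp_all
  have Q: "matching El b ?Q" "fst ` ?Q = insert v (fst ` P) - {u}" and dist: "distinct (snd s)"
    using s unfolding sound_state_def h by (simp_all del: insert_iff)
  have loc: "e \<in> P \<inter> ?Q \<or> fst e \<in> H" if "e \<in> P \<union> ?Q" for e
    using s that unfolding sound_state_def by blast
  have conf: "conflict adj ?e q \<longleftrightarrow> b q = b ?e" if "q \<in> ?Q" for q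
  proof -
    have "fst q \<noteq> u" using Q(2) that by blast
    moreover have "elig q" "elig ?e" using that Q(1) c by (auto simp: matching_def El_def)
    ultimately show ?thesis using block[of ?e q] by auto
  qed
  have uQ: "u \<notin> fst ` ?Q" using Q(2) by blast
  show "fst ?t \<noteq> [] \<Longrightarrow> \<exists>q\<in>?Q. b q = b ?e \<and> fst ?t = [fst q]"
    by (cases rule: recolor_cases[of "snd s" adj ?e]) (use conf in auto)
  show "sound_state El b P v (H \<union> set (fst ?t)) ?t"
  proof (cases rule: recolor_cases[of "snd s" adj ?e])
    case free
    then have "b ?e \<notin> b ` ?Q" using conf by force
    then have "matching El b (insert ?e ?Q)" using Q(1) c uQ by (auto simp: matching_def)
    moreover have "fst ` insert ?e ?Q = insert v (fst ` P)" using Q(2) h(2) by auto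
    moreover have "distinct (?e # snd s)" using uQ dist by force
    ultimately show ?thesis using free loc u(2) by (auto simp: sound_state_def)
  next
    case (evict q)
    have "b q = b ?e" using conf evict(1,2) by blast
    then have set: "set (snd ?t) = insert ?e (?Q - {q})"
      using evict conf Q(1) by (auto simp: matching_def inj_on_def)
    have be: "b ?e \<notin> b ` (?Q - {q})"
      using \<open>b q = b ?e\<close> evict(1) Q(1) by (auto simp: matching_def inj_on_def)
    have "matching El b (insert ?e (?Q - {q}))"
      using Q(1) c uQ be by (auto simp: matching_def inj_on_diff)
    moreover have "fst ` insert ?e (?Q - {q}) = insert v (fst ` P) - {fst q}"
    proof -
      have "fst ` (?Q - {q}) = fst ` ?Q - {fst q}"
        using Q(1) evict(1) by (auto simp: matching_def inj_on_def)
      moreover have "fst q \<noteq> u" using uQ evict(1) by auto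
      ultimately show ?thesis using Q(2) h(2) by auto
    qed
    moreover have "b ` insert ?e (?Q - {q}) = b ` P"
      using bQ \<open>b q = b ?e\<close> evict(1) by (metis image_insert insert_Diff)
    moreover have "fst q \<in> insert v (fst ` P)" using Q(2) evict(1) by auto
    moreover have "e \<in> P \<inter> insert ?e (?Q - {q}) \<or> fst e \<in> H \<union> {fst q}"
      if "e \<in> P \<union> insert ?e (?Q - {q})" for e
      using loc[of e] that u(2) by auto
    moreover have "distinct (snd ?t)" using evict(3) uQ dist by force
    ultimately show ?thesis unfolding sound_state_def set using evict(3) by auto
  qed
qed

lemma sound_state_expand:
  assumes "\<forall>s\<in>set T. sound_state El b P v (\<Union>t\<in>set T. set (fst t)) s"
  shows "\<forall>s\<in>set (expand adj elig cs T). sound_state El b P v (\<Union>t\<in>set (expand adj elig cs T). set (fst t)) s"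
proof
  let ?T' = "expand adj elig cs T"
  fix s assume s: "s \<in> set ?T'"
  have sub: "set T \<subseteq> set ?T'" using foldr_insert_state_mem unfolding expand_def by blast
  consider "s \<in> set T" | "s \<in> set (successors adj elig cs T)"
    using s foldr_insert_state_mem[of T "successors adj elig cs T"] by (auto simp: expand_def)
  then show "sound_state El b P v (\<Union>t\<in>set ?T'. set (fst t)) s"
  proof cases
    case 1
    then show ?thesis using assms sub by (blast intro: sound_state_mono)
  next
    case 2
    then obtain t u c where t: "t \<in> set T" "u \<in> set (fst t)" "c \<in> set cs" "elig (u, c)"
      "s = recolor adj (snd t) (u, c)" unfolding successors_mem by blast
    let ?H = "\<Union>t\<in>set T. set (fst t)"
    have "sound_state El b P v (?H \<union> set (fst s)) s"
      unfolding t(5) using t assms by (intro sound_state_recolor(1)) (auto simp: El_def)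
    then show ?thesis using s sub by (elim sound_state_mono) blast
  qed
qed

lemma sound_state_reachable:
  assumes P: "matching El b (set P)" "v \<notin> fst ` set P" "distinct P"
  shows "\<forall>s\<in>set (reachable adj elig cs P v n).
    sound_state El b (set P) v (\<Union>t\<in>set (reachable adj elig cs P v n). set (fst t)) s"
proof (induction n)
  case 0
  then show ?case using P by (auto simp: reachable_def sound_state_def)
next
  case (Suc n)
  then show ?case using sound_state_expand[OF Suc] by (simp add: reachable_def)
qed

lemma start_reachable: "([v], P) \<in> set (reachable adj elig cs P v n)"
proof (induction n)
  case (Suc n)
  then show ?case
    using foldr_insert_state_mem[of "reachable adj elig cs P v n"
      "successors adj elig cs (reachable adj elig cs P v n)"]
    by (auto simp: reachable_def expand_def)
qed (simp add: reachable_def)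

lemma augment_optimal:
  fixes \<omega> :: "nat \<Rightarrow> rat"
  assumes P: "matching El b (set P)" "fst ` set P \<subseteq> V" "distinct P" and v: "v \<notin> V"
    and opt: "\<And>X. matching El b X \<Longrightarrow> fst ` X \<subseteq> V \<Longrightarrow> sum \<omega> (fst ` X) \<le> sum \<omega> (fst ` set P)"
    and le: "\<And>Q R. Q \<in> \<Q> \<Longrightarrow> R \<in> \<Q> \<Longrightarrow> le Q R \<longleftrightarrow> sum \<omega> (fst ` set Q) \<le> sum \<omega> (fst ` set R)"
    and \<Q>: "\<Q> = {Q. matching El b (set Q) \<and> distinct Q \<and> fst ` set Q \<subseteq> insert v V}"
  shows "augment adj elig cs le P v \<in> \<Q>"
    and "matching El b X \<Longrightarrow> fst ` X \<subseteq> insert v V \<Longrightarrow>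
      sum \<omega> (fst ` X) \<le> sum \<omega> (fst ` set (augment adj elig cs le P v))"
proof -
  define S where "S = reachable adj elig cs P v (Suc (Suc (length P)))"
  define H where "H = (\<Union>t\<in>set S. set (fst t))"
  have vP: "v \<notin> fst ` set P" using P(2) v by auto
  have sound: "sound_state El b (set P) v H s" if "s \<in> set S" for s
    using sound_state_reachable[OF P(1) vP P(3)] that unfolding S_def H_def by blast
  have aug: "augment adj elig cs le P v = best le [] (map snd S)"
    by (simp add: augment_def S_def)
  have Nil: "[] \<in> \<Q>" by (simp add: \<Q> matching_def)
  have mem: "snd s \<in> \<Q>" if "s \<in> set S" for s
    using sound[OF that] P(2) unfolding sound_state_def \<Q> by auto
  have all: "insert [] (set (map snd S)) \<subseteq> \<Q>" using Nil mem by auto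
  with best_mem[of le "[]" "map snd S"] show "augment adj elig cs le P v \<in> \<Q>"
    unfolding aug by blast
  have ge: "sum \<omega> (fst ` set (snd s)) \<le> sum \<omega> (fst ` set (augment adj elig cs le P v))"
    if "s \<in> set S" for s
    unfolding aug
  proof (rule best_ge[where w = "\<lambda>Q. sum \<omega> (fst ` set Q)"])
    show "snd s \<in> insert [] (set (map snd S))" using that by auto
  qed (use le all in blast)
  assume X: "matching El b X" "fst ` X \<subseteq> insert v V"
  let ?T = "(\<lambda>s. (set (fst s), set (snd s))) ` set S"
  \<comment> \<open>An eligible color at a hole produces a successor, and saturation provides a
    stored state with the same hole as that successor.\<close>
  have hole: "{} \<in> fst ` ?T \<or> (\<exists>q\<in>set (snd s). b q = b e \<and> {fst q} \<in> fst ` ?T)"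
    if s: "s \<in> set S" and e: "e \<in> El" "fst e \<in> set (fst s)" for s e
  proof -
    obtain u c where uc: "e = (u, c)" by (cases e)
    let ?t = "recolor adj (snd s) (u, c)"
    have "?t \<in> set (successors adj elig cs S)"
      using s e uc unfolding successors_mem El_def by fastforce
    then obtain t where t: "t \<in> set S" "set (fst ?t) = set (fst t)"
      using reachable_closed unfolding S_def by blast
    have uH: "u \<in> H" using s e uc by (auto simp: H_def)
    have m: "h \<in> fst ` ?T" if "set (fst ?t) = h" for h
      using t that by force
    consider "fst ?t = []" | q where "q \<in> set (snd s)" "b q = b e" "fst ?t = [fst q]"
      using sound_state_recolor(2)[OF sound[OF s], of u c] e uc uH by (metis fst_conv)
    then show ?thesis
    proof cases
      case 1
      then show ?thesis by (intro disjI1 m) simp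
    next
      case (2 q)
      then show ?thesis by (intro disjI2 bexI[of _ q] conjI m) simp_all
    qed
  qed
  have "\<exists>(h, Q)\<in>?T. sum \<omega> (fst ` X) \<le> sum \<omega> (fst ` Q)"
  proof (rule exchange_optimal[OF P(1,2) v opt])
    show "({v}, set P) \<in> ?T"
      using start_reachable[of v P "Suc (Suc (length P))"] unfolding S_def[symmetric] by force
  next
    fix h Q assume "(h, Q) \<in> ?T"
    then obtain s where s: "s \<in> set S" "h = set (fst s)" "Q = set (snd s)" by auto
    from sound[OF s(1)] show "matching El b Q \<and> fst ` Q = insert v (fst ` set P) - h"
      unfolding s sound_state_def by blast
    have "fst s = [] \<or> (\<exists>u\<in>insert v (fst ` set P). fst s = [u]) \<and> b ` set (snd s) = b ` set P"
      using sound[OF s(1)] unfolding sound_state_def by blast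
    then show "h = {} \<or> (\<exists>u\<in>insert v (fst ` set P). h = {u}) \<and> b ` Q = b ` set P"
      unfolding s by (metis list.set(1) list.simps(15))
    have "\<Union> (fst ` ?T) = H" by (auto simp: H_def)
    then show "fst e \<in> \<Union> (fst ` ?T)" if "e \<in> set P \<union> Q" "e \<notin> set P \<inter> Q" for e
      using that sound[OF s(1)] unfolding s sound_state_def by blast
    show "{} \<in> fst ` ?T \<or> (\<exists>q\<in>Q. b q = b e \<and> {fst q} \<in> fst ` ?T)" if "e \<in> El" "fst e \<in> h" for e
      using hole[OF s(1)] that unfolding s by blast
  qed (use X in auto)
  then obtain s where "s \<in> set S" "sum \<omega> (fst ` X) \<le> sum \<omega> (fst ` set (snd s))" by auto
  with ge show "sum \<omega> (fst ` X) \<le> sum \<omega> (fst ` set (augment adj elig cs le P v))" by fastforce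
qed

lemma max_weight_coloring_optimal:
  fixes \<omega> :: "nat \<Rightarrow> rat"
  assumes "distinct vs"
    and le: "\<And>Q R. Q \<in> \<Q> \<Longrightarrow> R \<in> \<Q> \<Longrightarrow> le Q R \<longleftrightarrow> sum \<omega> (fst ` set Q) \<le> sum \<omega> (fst ` set R)"
    and \<Q>: "\<Q> = {Q. matching El b (set Q) \<and> distinct Q \<and> fst ` set Q \<subseteq> set vs}"
  shows "max_weight_coloring adj elig cs le vs \<in> \<Q> \<and>
    (\<forall>X. matching El b X \<longrightarrow> fst ` X \<subseteq> set vs \<longrightarrow>
      sum \<omega> (fst ` X) \<le> sum \<omega> (fst ` set (max_weight_coloring adj elig cs le vs)))"
  using assms
proof (induction vs arbitrary: \<Q>)
  case Nil
  then show ?case by (auto simp: max_weight_coloring_def matching_def)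
next
  case (Cons v vs)
  let ?P = "max_weight_coloring adj elig cs le vs"
  let ?Q = "{Q. matching El b (set Q) \<and> distinct Q \<and> fst ` set Q \<subseteq> set vs}"
  have IH: "?P \<in> ?Q \<and> (\<forall>X. matching El b X \<longrightarrow> fst ` X \<subseteq> set vs \<longrightarrow>
      sum \<omega> (fst ` X) \<le> sum \<omega> (fst ` set ?P))"
  proof (rule Cons.IH[OF _ _ refl])
    fix Q R assume "Q \<in> ?Q" "R \<in> ?Q"
    then show "le Q R \<longleftrightarrow> sum \<omega> (fst ` set Q) \<le> sum \<omega> (fst ` set R)"
      unfolding Cons.prems(3) by (intro Cons.prems(2)) (auto simp: Cons.prems(3))
  qed (use Cons.prems(1) in simp)
  have step: "max_weight_coloring adj elig cs le (v # vs) = augment adj elig cs le ?P v"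
    by (simp add: max_weight_coloring_def)
  have P: "matching El b (set ?P)" "fst ` set ?P \<subseteq> set vs" "distinct ?P" and v: "v \<notin> set vs"
    using IH Cons.prems(1) by auto
  have opt: "sum \<omega> (fst ` X) \<le> sum \<omega> (fst ` set ?P)"
    if "matching El b X" "fst ` X \<subseteq> set vs" for X using IH that by blast
  show ?case
    unfolding step
    using augment_optimal[OF P v opt Cons.prems(2), of \<Q>] Cons.prems(3) by auto
qed

end


section \<open>Covering independent sets by induced \<open>P\<^sub>3\<close>-free subgraphs\<close>

definition p3_free :: "(nat \<Rightarrow> nat \<Rightarrow> bool) \<Rightarrow> nat set \<Rightarrow> bool" where
  "p3_free adj A \<longleftrightarrow>
    (\<forall>a\<in>A. \<forall>b\<in>A. \<forall>c\<in>A. a = c \<or> \<not> adj a b \<or> \<not> adj b c \<or> adj a c)"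

definition apart :: "(nat \<Rightarrow> nat \<Rightarrow> bool) \<Rightarrow> nat \<Rightarrow> nat \<Rightarrow> nat \<Rightarrow> nat \<Rightarrow> bool" where
  "apart adj a b c u \<longleftrightarrow>
    u \<noteq> a \<and> u \<noteq> b \<and> u \<noteq> c \<and> \<not> adj a u \<and> \<not> adj b u \<and> \<not> adj c u"

text \<open>The triple \<open>v\<close>, \<open>a\<close>, \<open>b\<close> stands for a
  \<open>P_3\<close>, and \<open>[v]\<close> or \<open>[v, b]\<close> for its intersection with the
  independent set. All pairs are tried without testing for a \<open>P_3\<close>: the extra ones
  still give \<open>P_3\<close>-free members, because vertices kept by \<open>apart\<close> are not
  adjacent to \<open>v\<close> or \<open>b\<close>.\<close>

definition new_covers ::
    "(nat \<Rightarrow> nat \<Rightarrow> bool) \<Rightarrow> (nat list \<Rightarrow> nat list list) \<Rightarrow> nat \<Rightarrow> nat list \<Rightarrow> nat list list" where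
  "new_covers adj F v us =
    concat (map (\<lambda>a. concat (map (\<lambda>b. concat (map (\<lambda>X. map (\<lambda>S. X @ S)
      (F (filter (apart adj v a b) us))) [[v], [v, b]])) us)) us)"

fun cover_step ::
    "(nat \<Rightarrow> nat \<Rightarrow> bool) \<Rightarrow> (nat list \<Rightarrow> nat list list) \<Rightarrow> nat list \<Rightarrow> nat list list" where
  "cover_step adj F [] = [[]]"
| "cover_step adj F (v # us) =
    map (\<lambda>S. if p3_free adj (set (v # S)) then v # S else S) (cover_step adj F us) @
    new_covers adj F v us"

text \<open>The empty family for 0 is consistent with completeness, since
  \<open>has_p3s adj 0\<close> always holds.\<close>

fun p3_cover :: "(nat \<Rightarrow> nat \<Rightarrow> bool) \<Rightarrow> nat \<Rightarrow> nat list \<Rightarrow> nat list list" where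
  "p3_cover adj 0 vs = []"
| "p3_cover adj (Suc k) vs = cover_step adj (p3_cover adj k) vs"

text \<open>An induced \<open>kP_3\<close>, peeled off one path at a time to match the recursion of
  \<open>p3_cover\<close>; \<open>has_p3s_embedding\<close> relates it to
  \<open>copies\<close>.\<close>

fun has_p3s :: "(nat \<Rightarrow> nat \<Rightarrow> bool) \<Rightarrow> nat \<Rightarrow> nat set \<Rightarrow> bool" where
  "has_p3s adj 0 U = True"
| "has_p3s adj (Suc k) U =
    (\<exists>a\<in>U. \<exists>b\<in>U. \<exists>c\<in>U. a \<noteq> c \<and> adj a b \<and> adj b c \<and> \<not> adj a c \<and>
      has_p3s adj k {u \<in> U. apart adj a b c u})"

lemma has_p3s_mono: "has_p3s adj k U \<Longrightarrow> U \<subseteq> U' \<Longrightarrow> has_p3s adj k U'"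
proof (induction k arbitrary: U U')
  case (Suc k)
  then obtain a b c where abc: "a \<in> U" "b \<in> U" "c \<in> U" "a \<noteq> c" "adj a b" "adj b c" "\<not> adj a c"
    "has_p3s adj k {u \<in> U. apart adj a b c u}" by auto
  have "has_p3s adj k {u \<in> U'. apart adj a b c u}"
    by (rule Suc.IH[OF abc(8)]) (use Suc.prems(2) in auto)
  moreover have "a \<in> U'" "b \<in> U'" "c \<in> U'" using abc(1-3) Suc.prems(2) by auto
  ultimately show ?case unfolding has_p3s.simps using abc(4-7) by (intro bexI conjI)
qed simp

section \<open>Size and running time of the covering family\<close>

lemma new_covers_mem:
  "S \<in> set (new_covers adj F v us) \<longleftrightarrow>
    (\<exists>a\<in>set us. \<exists>b\<in>set us. \<exists>S'\<in>set (F (filter (apart adj v a b) us)). S = v # S' \<or> S = v # b # S')"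
  unfolding new_covers_def by auto

text \<open>One extra multiple of \<open>sz us\<close> pays for the vertices added along the list,
  the other for the vertex \<open>b\<close> put in front of a recursive cover.\<close>

lemma sz_cover_step_mem:
  assumes F: "\<And>us S. S \<in> set (F us) \<Longrightarrow> sz S \<le> m * sz us"
  shows "S \<in> set (cover_step adj F us) \<Longrightarrow> sz S \<le> (m + 2) * sz us"
proof (induction us arbitrary: S)
  case (Cons v us)
  from Cons.prems consider S' where "S' \<in> set (cover_step adj F us)" "S = S' \<or> S = v # S'"
    | a b S' where "b \<in> set us" "S' \<in> set (F (filter (apart adj v a b) us))" "S = v # S' \<or> S = v # b # S'"
    by (auto simp: new_covers_mem split: if_splits)
  then show ?case
  proof cases
    case 1
    have "sz S \<le> Suc (sz v + sz S')" using 1(2) by auto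
    also have "\<dots> \<le> Suc (sz v) + (m + 2) * sz us" using Cons.IH[OF 1(1)] by simp
    also have "\<dots> \<le> (m + 2) * sz (v # us)" by (simp add: algebra_simps)
    finally show ?thesis .
  next
    case 2
    have "sz S \<le> Suc (sz v) + (Suc (sz b) + sz S')" using 2(3) by auto
    also have "Suc (sz b) \<le> sz us + 1" using sz_mem_le[OF 2(1)] by simp
    also have "sz S' \<le> m * sz us"
      using F[OF 2(2)] sz_filter_le[of "apart adj v a b" us] by (meson le_trans mult_le_mono2)
    finally show ?thesis by (simp add: algebra_simps)
  qed
qed simp

lemma sz_p3_cover_mem: "S \<in> set (p3_cover adj k us) \<Longrightarrow> sz S \<le> (2 * k) * sz us"
proof (induction k arbitrary: us S)
  case (Suc k)
  show ?case
    using sz_cover_step_mem[of "p3_cover adj k" "2 * k" S adj us] Suc by simp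
qed simp

text \<open>The family grows by addition, not by multiplication: each member for \<open>us\<close>
  yields exactly one member for \<open>v # us\<close>, and all others come from
  \<open>new_covers\<close>.\<close>

lemma length_cover_step_le:
  assumes "\<And>v ws. sz (v # ws) \<le> n \<Longrightarrow> length (new_covers adj F v ws) \<le> N"
  shows "sz us \<le> n \<Longrightarrow> length (cover_step adj F us) \<le> Suc (length us * N)"
proof (induction us)
  case (Cons v us)
  then show ?case using assms[of v us] by simp
qed simp

lemma ptime_p3_free:
  assumes adj: "ptime (\<lambda>z. adj (fst z) (fst (snd z)) (snd (snd z)))" and "ptime a" "ptime S"
  shows "ptime (\<lambda>x. p3_free (adj (a x)) (set (S x)))"
  unfolding p3_free_def
  by (intro ptime_intros ptime_comp3[OF adj] assms(2-) assms(2-)[THEN ptime_comp])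

lemma ptime_apart:
  assumes adj: "ptime (\<lambda>z. adj (fst z) (fst (snd z)) (snd (snd z)))"
    and "ptime e" "ptime a" "ptime b" "ptime c" "ptime u"
  shows "ptime (\<lambda>x. apart (adj (e x)) (a x) (b x) (c x) (u x))"
  unfolding apart_def by (intro ptime_intros ptime_comp3[OF adj] assms(2-))

lemma ptime_new_covers:
  assumes adj: "ptime (\<lambda>z. adj (fst z) (fst (snd z)) (snd (snd z)))"
    and F: "ptime (\<lambda>z. F (fst z) (snd z))" and "ptime e" "ptime v" "ptime us"
  shows "ptime (\<lambda>x. new_covers (adj (e x)) (F (e x)) (v x) (us x))"
  unfolding new_covers_def
  by (intro ptime_intros ptime_comp2[OF F] ptime_apart[OF adj] assms(3-) assms(3-)[THEN ptime_comp])

lemma ptime_cover_step: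
  assumes adj: "ptime (\<lambda>z. adj (fst z) (fst (snd z)) (snd (snd z)))"
    and F: "ptime (\<lambda>z. F (fst z) (snd z))" and us: "ptime us"
    and m: "\<And>x us S. S \<in> set (F x us) \<Longrightarrow> sz S \<le> m * sz us"
  shows "ptime (\<lambda>x. cover_step (adj x) (F x) (us x))"
proof (rule ptime_list_rec[where g = "\<lambda>x us. cover_step (adj x) (F x) us" and a = "\<lambda>_. [[]]" and
      s = "\<lambda>x v us r. map (\<lambda>S. if p3_free (adj x) (set (v # S)) then v # S else S) r @
        new_covers (adj x) (F x) v us", OF _ _ _ _ _ ptime_id us])
  have new: "ptime (\<lambda>z. new_covers (adj (fst z)) (F (fst z)) (fst (snd z)) (snd (snd z)))"
    by (intro ptime_new_covers adj F ptime_intros)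
  obtain p where p': "\<forall>z. sz (new_covers (adj (fst z)) (F (fst z)) (fst (snd z)) (snd (snd z))) \<le> poly p (sz z)"
    using pbounded_sz[OF new] unfolding pbounded_def by blast
  have p: "sz (new_covers (adj x) (F x) v us) \<le> poly p (sz (x, v, us))" for x v us
    using spec[OF p', of "(x, v, us)"] by simp
  have "sz (cover_step (adj x) (F x) us) \<le>
      Suc (sz us * poly p (sz (x, us))) * Suc ((m + 2) * sz us)" for x us
  proof -
    have "length (new_covers (adj x) (F x) v ws) \<le> poly p (sz (x, us))" if "sz (v # ws) \<le> sz us" for v ws
    proof -
      have "length (new_covers (adj x) (F x) v ws) \<le> poly p (sz (x, v, ws))"
        using length_le_sz p le_trans by blast
      also have "\<dots> \<le> poly p (sz (x, us))" using that by (intro poly_mono_nat) simp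
      finally show ?thesis .
    qed
    then have len: "length (cover_step (adj x) (F x) us) \<le> Suc (length us * poly p (sz (x, us)))"
      by (rule length_cover_step_le) auto
    have "sz (cover_step (adj x) (F x) us) \<le> length (cover_step (adj x) (F x) us) * Suc ((m + 2) * sz us)"
      by (intro sz_list_le sz_cover_step_mem m)
    also have "\<dots> \<le> Suc (length us * poly p (sz (x, us))) * Suc ((m + 2) * sz us)"
      by (intro mult_le_mono1 len)
    also have "\<dots> \<le> Suc (sz us * poly p (sz (x, us))) * Suc ((m + 2) * sz us)"
      using length_le_sz[of us] by (intro mult_le_mono1 Suc_le_mono[THEN iffD2])
    finally show ?thesis .
  qed
  moreover have "pbounded (\<lambda>z :: 'a \<times> nat list.
      Suc (sz (snd z) * poly p (sz (fst z, snd z))) * Suc ((m + 2) * sz (snd z)))"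
    by (intro pbounded_intros ptime_intros)
  ultimately show "pbounded (\<lambda>z. sz (cover_step (adj (fst z)) (F (fst z)) (snd z)))"
    by (elim pbounded_mono) blast
qed (simp, simp, (intro ptime_intros ptime_p3_free[OF adj] ptime_new_covers[OF adj F])+)

text \<open>\<open>k\<close> is not an input: each level is one more application of the closure
  rule, so the program and the degree of its time bound may depend on \<open>k\<close>.\<close>

lemma ptime_p3_cover:
  assumes adj: "ptime (\<lambda>z. adj (fst z) (fst (snd z)) (snd (snd z)))" and us: "ptime us"
  shows "ptime (\<lambda>x. p3_cover (adj x) k (us x))"
proof -
  have "ptime (\<lambda>z. p3_cover (adj (fst z)) k (snd z))"
  proof (induction k)
    case 0
    then show ?case by (simp add: ptime_intros)
  next
    case (Suc k)
    show ?case
      unfolding p3_cover.simps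
    proof (rule ptime_cover_step)
      show "ptime (\<lambda>z. adj (fst (fst z)) (fst (snd z)) (snd (snd z)))"
        by (intro ptime_comp3[OF adj] ptime_intros)
      show "ptime (\<lambda>z. p3_cover (adj (fst (fst z))) k (snd z))"
        by (intro ptime_comp2[OF Suc] ptime_intros)
    qed (intro ptime_intros, erule sz_p3_cover_mem)
  qed
  then show ?thesis by (intro ptime_comp2[OF _ ptime_id us])
qed

section \<open>Correctness of the covering family\<close>

lemma p3_freeD: "p3_free adj A \<Longrightarrow> a \<in> A \<Longrightarrow> b \<in> A \<Longrightarrow> c \<in> A \<Longrightarrow> a \<noteq> c \<Longrightarrow> adj a b \<Longrightarrow> adj b c \<Longrightarrow> adj a c"
  unfolding p3_free_def by blast

context
  fixes adj :: "nat \<Rightarrow> nat \<Rightarrow> bool"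
  assumes sym: "adj a b \<Longrightarrow> adj b a" and irrefl: "\<not> adj a a"
begin

lemma cover_step_sound:
  assumes F: "\<And>us S. S \<in> set (F us) \<Longrightarrow> set S \<subseteq> set us \<and> p3_free adj (set S)"
  shows "S \<in> set (cover_step adj F us) \<Longrightarrow> set S \<subseteq> set us \<and> p3_free adj (set S)"
proof (induction us arbitrary: S)
  case Nil
  then show ?case by (simp add: p3_free_def)
next
  case (Cons v us)
  from Cons.prems consider S' where "S' \<in> set (cover_step adj F us)"
      "S = S' \<or> p3_free adj (set (v # S')) \<and> S = v # S'"
    | a b S' where "a \<in> set us" "b \<in> set us" "S' \<in> set (F (filter (apart adj v a b) us))"
      "S = v # S' \<or> S = v # b # S'"
    by (auto simp: new_covers_mem split: if_splits)
  then show ?case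
  proof cases
    case 1
    with Cons.IH[OF 1(1)] show ?thesis by auto
  next
    case 2
    have S': "set S' \<subseteq> {u \<in> set us. apart adj v a b u}" "p3_free adj (set S')"
      using F[OF 2(3)] by auto
    define X where "X = (if S = v # S' then {v} else {v, b})"
    have X: "set S = X \<union> set S'" "X \<subseteq> {v, b}" using 2(4) by (auto simp: X_def)
    have no: "\<not> adj x s \<and> \<not> adj s x" if "x \<in> X" "s \<in> set S'" for x s
      using that X(2) S'(1) sym unfolding apart_def by blast
    \<comment> \<open>No edge joins \<open>X\<close> to \<open>set S'\<close>, so a
      \<open>P_3\<close> would lie on one side; but \<open>X\<close> has at most two vertices and
      \<open>set S'\<close> is \<open>P_3\<close>-free.\<close>
    have "p3_free adj (X \<union> set S')"
      unfolding p3_free_def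
    proof (intro ballI)
      fix x y z assume xyz: "x \<in> X \<union> set S'" "y \<in> X \<union> set S'" "z \<in> X \<union> set S'"
      show "x = z \<or> \<not> adj x y \<or> \<not> adj y z \<or> adj x z"
      proof (cases "y \<in> X")
        case True
        then have "x = z" if "adj x y" "adj y z"
          using that xyz no X(2) irrefl by (metis Un_iff insertE singletonD subsetD)
        then show ?thesis by blast
      next
        case False
        then show ?thesis using no xyz S'(2) unfolding p3_free_def by blast
      qed
    qed
    then show ?thesis using X 2 S'(1) by auto
  qed
qed

lemma p3_cover_sound: "S \<in> set (p3_cover adj k us) \<Longrightarrow> set S \<subseteq> set us \<and> p3_free adj (set S)"
proof (induction k arbitrary: us S)
  case (Suc k)
  then show ?case using cover_step_sound[of "p3_cover adj k" S us] by simp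
qed simp

text \<open>Let \<open>S\<close> contain \<open>J = I - {v}\<close> while \<open>insert v S\<close> induces some \<open>P\<^sub>3\<close>. A neighbor \<open>a \<in> S\<close> of \<open>v\<close>
  has at most one neighbor in \<open>J\<close>, because \<open>S\<close> is \<open>P\<^sub>3\<close>-free. If it has one, say \<open>y\<close>, then
  \<open>v, a, y\<close> is a \<open>P\<^sub>3\<close> and the rest of \<open>I\<close> is anticomplete to it. If no such \<open>a\<close> has a neighbor
  in \<open>J\<close>, then \<open>J\<close> is anticomplete to every \<open>P\<^sub>3\<close> of \<open>insert v S\<close> through \<open>v\<close>.\<close>

lemma p3_outside:
  assumes S: "p3_free adj S" "\<not> p3_free adj (insert v S)"
    and I: "v \<in> I" "I - {v} \<subseteq> S" "\<forall>x\<in>I. \<forall>y\<in>I. \<not> adj x y"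
  obtains
    (one) a b where "a \<in> S" "b \<in> S" "\<forall>u\<in>I - {v}. apart adj v a b u"
      "a \<noteq> b \<and> adj a v \<and> adj v b \<and> \<not> adj a b \<or> v \<noteq> b \<and> adj v a \<and> adj a b \<and> \<not> adj v b"
  | (two) a b where "a \<in> S" "b \<in> S" "b \<in> I" "\<forall>u\<in>I - {v, b}. apart adj v a b u"
      "v \<noteq> b \<and> adj v a \<and> adj a b \<and> \<not> adj v b"
proof (cases "\<exists>a\<in>S. \<exists>y\<in>I - {v}. adj v a \<and> adj a y")
  case True
  then obtain a y where ay: "a \<in> S" "y \<in> I" "y \<noteq> v" "adj v a" "adj a y" by auto
  have "apart adj v a y u" if "u \<in> I - {v, y}" for u
  proof -
    have "\<not> adj a u"
      using p3_freeD[OF S(1), of y a u] ay that I sym by blast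
    moreover have "u \<noteq> a" using I(1,3) ay(4) that by blast
    ultimately show ?thesis using that I(1,3) ay(2) unfolding apart_def by blast
  qed
  with ay I show ?thesis by (intro two[of a y]) auto
next
  case False
  then have no: "\<not> adj a y" if "a \<in> S" "adj v a" "y \<in> I - {v}" for a y using that by blast
  obtain x y z where xyz: "x \<in> insert v S" "y \<in> insert v S" "z \<in> insert v S"
    "x \<noteq> z" "adj x y" "adj y z" "\<not> adj x z" using S(2) unfolding p3_free_def by blast
  have basic: "apart adj v a b u"
    if "a \<in> S" "adj v a" "u \<in> I - {v}" "u \<noteq> b" "\<not> adj b u" for a b u
    using that no[OF that(1,2,3)] I(1,3) unfolding apart_def by blast
  have ends: ?thesis if "adj v a" "adj a b" "\<not> adj v b" "v \<noteq> b" "a \<in> S" "b \<in> S" for a b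
  proof (rule one[OF that(5,6)])
    show "\<forall>u\<in>I - {v}. apart adj v a b u"
    proof
      fix u assume u: "u \<in> I - {v}"
      have "u \<noteq> b" using no[OF that(5,1) u] that(2) by blast
      moreover have "\<not> adj b u"
      proof
        assume "adj b u"
        moreover have "u \<noteq> a" using I(1,3) that(1) u by blast
        ultimately have "adj a u" using p3_freeD[OF S(1), of a b u] that u I(2) by blast
        then show False using no[OF that(5,1) u] by blast
      qed
      ultimately show "apart adj v a b u" using basic that u by blast
    qed
  qed (use that in blast)
  consider "y = v" "x \<in> S" "z \<in> S" | "x = v" "y \<in> S" "z \<in> S" | "z = v" "y \<in> S" "x \<in> S"
  proof -
    have "\<not> (x \<in> S \<and> y \<in> S \<and> z \<in> S)" using xyz p3_freeD[OF S(1)] by blast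
    then show thesis using that xyz irrefl by blast
  qed
  then show ?thesis
  proof cases
    case 1
    have vx: "adj v x" "adj v z" using 1 xyz sym by auto
    show ?thesis
    proof (rule one[of x z])
      show "\<forall>u\<in>I - {v}. apart adj v x z u"
      proof
        fix u assume u: "u \<in> I - {v}"
        have "u \<noteq> z" using I(1,3) vx(2) u by blast
        then show "apart adj v x z u" using basic[OF 1(2) vx(1) u] no[OF 1(3) vx(2) u] by blast
      qed
    qed (use 1 xyz in auto)
  next
    case 2
    then show ?thesis using ends[of y z] xyz by blast
  next
    case 3
    then show ?thesis using ends[of y x] xyz sym by blast
  qed
qed

lemma p3_cover_complete:
  assumes "\<not> has_p3s adj k (set vs)" "I \<subseteq> set vs" "\<And>x y. x \<in> I \<Longrightarrow> y \<in> I \<Longrightarrow> \<not> adj x y"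
  shows "\<exists>S\<in>set (p3_cover adj k vs). I \<subseteq> set S"
  using assms
proof (induction k arbitrary: vs I)
  case (Suc k)
  note IH = Suc.IH
  show ?case using Suc.prems
  proof (induction vs arbitrary: I)
    case (Cons v us)
    let ?C = "p3_cover adj (Suc k)"
    have us: "\<not> has_p3s adj (Suc k) (set us)"
      using Cons.prems(1) has_p3s_mono set_subset_Cons by metis
    have "I - {v} \<subseteq> set us" using Cons.prems(2) by auto
    then obtain S where S: "S \<in> set (?C us)" "I - {v} \<subseteq> set S"
      using Cons.IH[OF us] Cons.prems(3) by (metis DiffD1)
    have S_us: "set S \<subseteq> set us" "p3_free adj (set S)"
      using p3_cover_sound[OF S(1)] by auto
    show ?case
    proof (cases "v \<in> I \<and> \<not> p3_free adj (insert v (set S))")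
      case False
      let ?S = "if p3_free adj (set (v # S)) then v # S else S"
      have "?S \<in> set (?C (v # us))" using S(1) by auto
      moreover have "I \<subseteq> set ?S" using False S(2) by auto
      ultimately show ?thesis by blast
    next
      case True
      \<comment> \<open>A \<open>P_3\<close> through \<open>v\<close> and \<open>k\<close> paths
        apart from it would be \<open>Suc k\<close> paths in \<open>v # us\<close>, so the outer
        induction hypothesis applies to the filtered vertices.\<close>
      have rec: "\<exists>S\<in>set (p3_cover adj k (filter (apart adj v a b) us)). J \<subseteq> set S"
        if ab: "a \<in> set us" "b \<in> set us" and J: "J \<subseteq> I - {v}" "\<forall>u\<in>J. apart adj v a b u"
          and p3: "a \<noteq> b \<and> adj a v \<and> adj v b \<and> \<not> adj a b \<or> v \<noteq> b \<and> adj v a \<and> adj a b \<and> \<not> adj v b"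
        for a b J
      proof (rule IH)
        have swap: "apart adj a v b = apart adj v a b" by (auto simp: apart_def)
        have "\<not> has_p3s adj k {u \<in> set (v # us). apart adj v a b u}"
        proof
          assume rest: "has_p3s adj k {u \<in> set (v # us). apart adj v a b u}"
          have "has_p3s adj (Suc k) (set (v # us))"
            using p3
          proof
            assume "a \<noteq> b \<and> adj a v \<and> adj v b \<and> \<not> adj a b"
            then show ?thesis unfolding has_p3s.simps
              using ab rest swap by (intro bexI[of _ a] bexI[of _ v] bexI[of _ b]) simp_all
          next
            assume "v \<noteq> b \<and> adj v a \<and> adj a b \<and> \<not> adj v b"
            then show ?thesis unfolding has_p3s.simps
              using ab rest by (intro bexI[of _ v] bexI[of _ a] bexI[of _ b]) simp_all
          qed
          with Cons.prems(1) show False by blast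
        qed
        then show "\<not> has_p3s adj k (set (filter (apart adj v a b) us))"
          using has_p3s_mono[of adj k "set (filter (apart adj v a b) us)"
              "{u \<in> set (v # us). apart adj v a b u}"] by auto
        show "J \<subseteq> set (filter (apart adj v a b) us)" using J Cons.prems(2) by auto
        show "\<not> adj x y" if "x \<in> J" "y \<in> J" for x y using Cons.prems(3) that J(1) by blast
      qed
      from True have v: "v \<in> I" "\<not> p3_free adj (insert v (set S))" by auto
      have indep: "\<forall>x\<in>I. \<forall>y\<in>I. \<not> adj x y" using Cons.prems(3) by blast
      show ?thesis
      proof (cases rule: p3_outside[OF S_us(2) v(2) v(1) S(2) indep, case_names one two])
        case (one a b)
        have ab: "a \<in> set us" "b \<in> set us" using one(1,2) S_us(1) by auto
        obtain S' where S': "S' \<in> set (p3_cover adj k (filter (apart adj v a b) us))" "I - {v} \<subseteq> set S'"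
          using rec[OF ab subset_refl one(3,4)] by blast
        have "v # S' \<in> set (?C (v # us))" using ab S'(1) by (auto simp: new_covers_mem)
        then show ?thesis using S'(2) by (intro bexI[of _ "v # S'"]) auto
      next
        case (two a b)
        have ab: "a \<in> set us" "b \<in> set us" using two(1,2) S_us(1) by auto
        obtain S' where S': "S' \<in> set (p3_cover adj k (filter (apart adj v a b) us))" "I - {v, b} \<subseteq> set S'"
          using rec[OF ab, of "I - {v, b}"] two(4,5) by blast
        have "v # b # S' \<in> set (?C (v # us))" using ab S'(1) by (auto simp: new_covers_mem)
        then show ?thesis using S'(2) by (intro bexI[of _ "v # b # S'"]) auto
      qed
    qed
  qed auto
qed simp

end


section \<open>The algorithm\<close>

text \<open>Vertices are the indices of the rows of the input; color \<open>c\<close> of the algorithm is color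
  \<open>Suc c\<close> of the instance.\<close>

type_synonym row = "bool list \<times> fraction \<times> bool list"

definition row :: "row list \<Rightarrow> nat \<Rightarrow> row" where
  "row M i = nth_default ([], ([], []), []) M i"

definition adjacent :: "row list \<Rightarrow> nat \<Rightarrow> nat \<Rightarrow> bool" where
  "adjacent M i j = nth_default False (fst (row M i)) j"

definition weight :: "row list \<Rightarrow> nat \<Rightarrow> fraction" where
  "weight M i = fst (snd (row M i))"

text \<open>The defaults make every pair ineligible whose vertex or color lies outside the input or
  whose color lies beyond the tuple.\<close>

definition eligible :: "row list \<Rightarrow> nat list list \<Rightarrow> nat \<times> nat \<Rightarrow> bool" where
  "eligible M t e \<longleftrightarrow>
    nth_default False (snd (snd (row M (fst e)))) (snd e) \<and> fst e \<in> set (nth_default [] t (snd e))"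

definition lighter :: "row list \<Rightarrow> (nat \<times> nat) list \<Rightarrow> (nat \<times> nat) list \<Rightarrow> bool" where
  "lighter M P Q \<longleftrightarrow> le_fraction (sum_fractions (map (\<lambda>p. weight M (fst p)) P))
    (sum_fractions (map (\<lambda>p. weight M (fst p)) Q))"

definition best_coloring :: "nat \<Rightarrow> nat \<Rightarrow> row list \<Rightarrow> (nat \<times> nat) list" where
  "best_coloring r k M = best (lighter M) []
    (map (\<lambda>t. max_weight_coloring (adjacent M) (eligible M t) [0..<r] (lighter M) [0..<length M])
      (List.n_lists r (p3_cover (adjacent M) k [0..<length M])))"

definition solve :: "nat \<Rightarrow> nat \<Rightarrow> row list \<Rightarrow> bool list" where
  "solve r k M = (let P = best_coloring r k M in map (\<lambda>i. \<exists>p\<in>set P. fst p = i) [0..<length M])"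

section \<open>Running time of the whole algorithm\<close>

lemma ptime_upt [ptime_intros]:
  assumes "ptime n" shows "ptime (\<lambda>x. [0..<n x])"
proof (rule ptime_nat_rec[where g = "\<lambda>_ n. [0..<n]" and a = "\<lambda>_. []" and
      s = "\<lambda>_ n r. r @ [n]", OF _ _ _ _ _ ptime_const[of "()"] assms])
  have "sz [0..<n] \<le> n * Suc n" for n
    using sz_list_le[of "[0..<n]" n] by simp
  moreover have "pbounded (\<lambda>z :: unit \<times> nat. sz (snd z) * Suc (sz (snd z)))"
    by (intro pbounded_intros ptime_intros)
  ultimately show "pbounded (\<lambda>z :: unit \<times> nat. sz [0..<snd z])"
    by (elim pbounded_mono) simp
qed (intro ptime_intros | simp)+

text \<open>\<open>n\<close> is fixed and the induction yields a separate program for every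
  \<open>n\<close>; the number of tuples is a polynomial of degree \<open>n\<close> in the length of
  the list.\<close>

lemma ptime_n_lists [ptime_intros]:
  "ptime f \<Longrightarrow> ptime (\<lambda>x. List.n_lists n (f x))"
proof (induction n)
  case (Suc n)
  then show ?case
    by (simp, intro ptime_intros Suc.prems[THEN ptime_comp]) auto
qed (simp add: ptime_intros)

lemma ptime_row: "ptime a \<Longrightarrow> ptime i \<Longrightarrow> ptime (\<lambda>x. row (a x) (i x))"
  unfolding row_def by (intro ptime_intros)

lemma ptime_adjacent: "ptime (\<lambda>z. adjacent (fst z) (fst (snd z)) (snd (snd z)))"
  unfolding adjacent_def by (intro ptime_intros ptime_row)

lemma ptime_eligible: "ptime (\<lambda>z. eligible (fst z) (fst (snd z)) (snd (snd z)))"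
  unfolding eligible_def by (intro ptime_intros ptime_row)

lemma ptime_lighter: "ptime (\<lambda>z. lighter (fst z) (fst (snd z)) (snd (snd z)))"
  unfolding lighter_def weight_def by (intro ptime_intros ptime_row)

lemma ptime_solve: "ptime (solve r k)"
proof -
  have "ptime (\<lambda>M. best_coloring r k M)"
    unfolding best_coloring_def
    by (intro ptime_best ptime_lighter ptime_intros ptime_max_weight_coloring ptime_p3_cover
        ptime_comp3[OF ptime_adjacent] ptime_comp3[OF ptime_eligible] ptime_comp3[OF ptime_lighter])
  then have "ptime (\<lambda>M. solve r k M)"
    unfolding solve_def by (intro ptime_intros)
  then show ?thesis by simp
qed

section \<open>Correctness\<close>

text \<open>A typed form of the instance whose tree is literally the prescribed encoding
  (\<open>enc_rows\<close>), so the program needs no parsing.\<close>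

definition rows :: "nat \<Rightarrow> mwlcis \<Rightarrow> row list" where
  "rows r I = map (\<lambda>v. (map (\<lambda>u. {v, u} \<in> edges (inst_graph I)) (vertex_list I),
     (bits (nat (fst (quotient_of (inst_weight I v)))), bits (nat (snd (quotient_of (inst_weight I v))))),
     map (\<lambda>c. c \<in> inst_lists I v) [1..<Suc r])) (vertex_list I)"

lemma enc_list_map: "(\<And>x. f x = enc (g x)) \<Longrightarrow> enc_list f xs = enc (map g xs)"
  by (induction xs) auto

lemma enc_rows: "enc_mwlcis r I = enc (rows r I)"
proof -
  have ind: "enc_list (\<lambda>x. enc_bool (Q x)) xs = enc (map Q xs)" for Q :: "nat \<Rightarrow> bool" and xs
    by (rule enc_list_map) (simp add: enc_Bool)
  have bs: "enc_list enc_bool bs = enc bs" for bs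
    by (induction bs) (auto simp: enc_Bool)
  show ?thesis
    unfolding enc_mwlcis_def rows_def
    by (rule enc_list_map) (simp add: enc_vertex_def enc_nonneg_rat_def enc_nat_def ind bs del: upt_Suc)
qed

locale instance_rows =
  fixes r :: nat and I :: mwlcis
  assumes inst: "mwlcis_instance r I"
begin

abbreviation "G \<equiv> inst_graph I"
abbreviation "vl \<equiv> vertex_list I"
abbreviation "n \<equiv> length vl"
abbreviation "M \<equiv> rows r I"
abbreviation "adj \<equiv> adjacent M"

lemma simple: "finite (verts G)" "\<And>e. e \<in> edges G \<Longrightarrow> e \<subseteq> verts G \<and> card e = 2"
  and nonneg: "v \<in> verts G \<Longrightarrow> 0 \<le> inst_weight I v"
  and lists: "v \<in> verts G \<Longrightarrow> inst_lists I v \<subseteq> {1..r}"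
  using inst by (auto simp: mwlcis_instance_def simple_graph_def list_assignment_def)

lemma vl: "set vl = verts G" "distinct vl"
  using simple by (auto simp: vertex_list_def)

lemma vl_nth_eq: "i < n \<Longrightarrow> j < n \<Longrightarrow> vl ! i = vl ! j \<longleftrightarrow> i = j"
  using vl(2) by (simp add: nth_eq_iff_index_eq)

lemma vl_nth_mem: "i < n \<Longrightarrow> vl ! i \<in> verts G"
  using vl(1) nth_mem by blast

lemma length_M: "length M = n"
  by (simp add: rows_def)

lemma adj_iff: "adj i j \<longleftrightarrow> i < n \<and> j < n \<and> {vl ! i, vl ! j} \<in> edges G"
  by (auto simp: adjacent_def row_def rows_def nth_default_def)

lemma adj_sym: "adj i j \<Longrightarrow> adj j i"
  by (auto simp: adj_iff insert_commute)

lemma adj_irrefl: "\<not> adj i i"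
  using simple(2) by (fastforce simp: adj_iff)

lemma listed_iff:
  "nth_default False (snd (snd (row M i))) c \<longleftrightarrow> i < n \<and> c < r \<and> Suc c \<in> inst_lists I (vl ! i)"
  by (auto simp: row_def rows_def nth_default_def simp del: upt_Suc)

definition \<omega> :: "nat \<Rightarrow> rat" where
  "\<omega> i = (if i < n then inst_weight I (vl ! i) else 0)"

text \<open>A nonnegative rational has a nonnegative numerator and a positive denominator, so
  passing to \<open>nat\<close> loses nothing.\<close>

lemma weight: "i < n \<Longrightarrow> valid_fraction (weight M i) \<and> fraction_val (weight M i) = \<omega> i"
proof -
  assume i: "i < n"
  let ?q = "inst_weight I (vl ! i)"
  obtain a d where ad: "quotient_of ?q = (a, d)" by fastforce
  then have d: "0 < d" "?q = of_int a / of_int d" by (auto simp: quotient_of_denom_pos quotient_of_div)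
  have "0 \<le> ?q" using nonneg i vl_nth_mem by blast
  then have "0 \<le> a" using d by (simp add: zero_le_divide_iff)
  then show ?thesis
    using i d ad by (simp add: weight_def row_def rows_def nth_default_def valid_fraction_def
        fraction_val_def val_bits \<omega>_def)
qed

lemma lighter_iff:
  assumes "distinct P" "inj_on fst (set P)" "fst ` set P \<subseteq> {..<n}"
    and "distinct Q" "inj_on fst (set Q)" "fst ` set Q \<subseteq> {..<n}"
  shows "lighter M P Q \<longleftrightarrow> sum \<omega> (fst ` set P) \<le> sum \<omega> (fst ` set Q)"
proof -
  have *: "valid_fraction (sum_fractions (map (\<lambda>p. weight M (fst p)) P)) \<and>
      fraction_val (sum_fractions (map (\<lambda>p. weight M (fst p)) P)) = sum \<omega> (fst ` set P)"
    if P: "distinct P" "inj_on fst (set P)" "fst ` set P \<subseteq> {..<n}" for P :: "(nat \<times> nat) list"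
  proof -
    have w: "valid_fraction (weight M (fst p)) \<and> fraction_val (weight M (fst p)) = \<omega> (fst p)" if "p \<in> set P" for p
      using P(3) that weight by auto
    have "sum_list (map fraction_val (map (\<lambda>p. weight M (fst p)) P)) = sum_list (map (\<lambda>p. \<omega> (fst p)) P)"
      using w by (simp add: comp_def cong: map_cong)
    also have "\<dots> = sum \<omega> (fst ` set P)"
      using P by (simp add: sum_list_distinct_conv_sum_set sum.reindex)
    finally show ?thesis
      using sum_fractions[of "map (\<lambda>p. weight M (fst p)) P"] w by simp
  qed
  show ?thesis unfolding lighter_def using *[OF assms(1-3)] *[OF assms(4-6)] by (simp add: le_fraction)
qed

text \<open>In a disjoint union of cliques the closed neighborhood of a vertex is its clique. It is
  taken among the vertices eligible for the color and tagged with that color.\<close>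

definition block :: "nat list list \<Rightarrow> nat \<times> nat \<Rightarrow> nat \<times> nat set" where
  "block t e = (snd e, {w. eligible M t (w, snd e) \<and> (w = fst e \<or> adj (fst e) w)})"

lemma coloring_blocks:
  assumes t: "\<forall>S\<in>set t. p3_free adj (set S)"
  shows "coloring_blocks adj (eligible M t) (block t)"
proof
  fix e e' assume e: "eligible M t e" "eligible M t e'" "fst e \<noteq> fst e'"
  obtain i c j d where ij: "e = (i, c)" "e' = (j, d)" by (cases e; cases e')
  have free: "p3_free adj (set (nth_default [] t c))"
  proof (cases "c < length t")
    case True
    then show ?thesis using t nth_mem by (simp add: nth_default_nth)
  next
    case False
    then show ?thesis by (simp add: nth_default_beyond p3_free_def)
  qed
  have mem: "w \<in> set (nth_default [] t c)" if "eligible M t (w, c)" for w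
    using that by (simp add: eligible_def)
  show "block t e = block t e' \<longleftrightarrow> conflict adj e e'"
  proof
    assume "block t e = block t e'"
    then have "c = d" "j \<in> {w. eligible M t (w, c) \<and> (w = i \<or> adj i w)}"
      using e ij by (auto simp: block_def)
    then show "conflict adj e e'" using e ij by (auto simp: conflict_def)
  next
    assume "conflict adj e e'"
    then have cd: "c = d" "adj i j" "adj j i" using ij adj_sym by (auto simp: conflict_def)
    have "(w = i \<or> adj i w) \<longleftrightarrow> (w = j \<or> adj j w)" if "eligible M t (w, c)" for w
      using p3_freeD[OF free, of i j w] p3_freeD[OF free, of j i w] mem that cd e ij by auto
    then show "block t e = block t e'" using cd ij by (auto simp: block_def)
  qed
qed

definition valid :: "nat list list \<Rightarrow> (nat \<times> nat) set \<Rightarrow> bool" where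
  "valid t P \<longleftrightarrow> matching (coloring_blocks.El (eligible M t) [0..<r]) (block t) P"

lemma El_iff:
  assumes "\<forall>S\<in>set t. p3_free adj (set S)"
  shows "e \<in> coloring_blocks.El (eligible M t) [0..<r] \<longleftrightarrow>
    fst e < n \<and> snd e < r \<and> Suc (snd e) \<in> inst_lists I (vl ! fst e) \<and> fst e \<in> set (nth_default [] t (snd e))"
  unfolding coloring_blocks.El_def[OF coloring_blocks[OF assms]] eligible_def listed_iff by auto

lemma sum_colored:
  assumes "A \<subseteq> {..<n}" shows "sum (inst_weight I) ((!) vl ` A) = sum \<omega> A"
proof -
  have "inj_on ((!) vl) A" using assms vl_nth_eq by (auto simp: inj_on_def)
  then have "sum (inst_weight I) ((!) vl ` A) = (\<Sum>i\<in>A. inst_weight I (vl ! i))"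
    by (simp add: sum.reindex)
  also have "\<dots> = sum \<omega> A" using assms by (intro sum.cong) (auto simp: \<omega>_def)
  finally show ?thesis .
qed

text \<open>A vertex carries at most one color since \<open>fst\<close> is injective on
  \<open>P\<close>; adjacent vertices of one color would share a block, which injectivity of
  \<open>block t\<close> excludes.\<close>

lemma valid_feasible:
  assumes t: "\<forall>S\<in>set t. p3_free adj (set S)" and P: "valid t P"
  shows "mwlcis_feasible I ((!) vl ` fst ` P)"
proof -
  interpret coloring_blocks adj "eligible M t" "[0..<r]" "block t" using coloring_blocks[OF t] .
  let ?F = "(!) vl ` fst ` P"
  have El: "fst p < n \<and> snd p < r \<and> Suc (snd p) \<in> inst_lists I (vl ! fst p)" "eligible M t p" if "p \<in> P" for p
  proof -
    have p: "p \<in> El" using that P by (auto simp: valid_def matching_def)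
    show "eligible M t p" using p by (simp add: El_def)
    show "fst p < n \<and> snd p < r \<and> Suc (snd p) \<in> inst_lists I (vl ! fst p)"
      using p unfolding El_iff[OF t] by blast
  qed
  have inj: "inj_on fst P" "inj_on (block t) P" using P by (auto simp: valid_def matching_def)
  define \<phi> where "\<phi> v = Suc (snd (SOME p. p \<in> P \<and> vl ! fst p = v))" for v
  have \<phi>: "\<phi> (vl ! fst p) = Suc (snd p)" if "p \<in> P" for p
  proof -
    have "(SOME q. q \<in> P \<and> vl ! fst q = vl ! fst p) = p"
    proof (rule some_equality)
      fix q assume q: "q \<in> P \<and> vl ! fst q = vl ! fst p"
      then have "fst q = fst p" using El(1) that vl_nth_eq by metis
      then show "q = p" using inj(1) q that by (auto dest: inj_onD)
    qed (use that in simp)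
    then show ?thesis by (simp add: \<phi>_def)
  qed
  have "\<phi> u \<noteq> \<phi> v" if uv: "{u, v} \<in> edges G" "{u, v} \<subseteq> ?F" for u v
  proof
    assume eq: "\<phi> u = \<phi> v"
    obtain p q where pq: "p \<in> P" "q \<in> P" "u = vl ! fst p" "v = vl ! fst q" using uv(2) by auto
    have adj: "adj (fst p) (fst q)" using pq uv(1) El by (simp add: adj_iff)
    then have "fst p \<noteq> fst q" using adj_irrefl by auto
    moreover have "conflict adj p q" using adj eq pq \<phi> by (simp add: conflict_def)
    ultimately have "block t p = block t q" using block[of p q] El(2) pq by blast
    then show False using inj(2) pq \<open>fst p \<noteq> fst q\<close> by (auto simp: inj_on_def)
  qed
  then have "coloring (induced G ?F) \<phi>"
    by (auto simp: coloring_def induced_def \<phi>_def)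
  moreover have "respects_lists (induced G ?F) (inst_lists I) \<phi>"
    using \<phi> El(1) by (auto simp: respects_lists_def induced_def)
  moreover have "?F \<subseteq> verts G" using El(1) vl_nth_mem by auto
  ultimately show ?thesis unfolding mwlcis_feasible_def by blast
qed

lemma cover_p3_free: "S \<in> set (p3_cover adj k us) \<Longrightarrow> p3_free adj (set S)"
  using p3_cover_sound[of adj S k us] adj_sym adj_irrefl by blast

text \<open>Each color class is independent and hence inside a member of the family; these members
  form the tuple. Two pairs in one block would be adjacent vertices of one class.\<close>

lemma feasible_valid:
  assumes F: "mwlcis_feasible I F" and no: "\<not> has_p3s adj k {..<n}"
  obtains t X where "t \<in> set (List.n_lists r (p3_cover adj k [0..<n]))" "valid t X" "(!) vl ` fst ` X = F"
proof -
  obtain \<phi> where \<phi>: "coloring (induced G F) \<phi>" "respects_lists (induced G F) (inst_lists I) \<phi>"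
    and sub: "F \<subseteq> verts G" using F by (auto simp: mwlcis_feasible_def)
  have lst: "\<phi> v \<in> inst_lists I v" "1 \<le> \<phi> v" "\<phi> v \<le> r" if "v \<in> F" for v
    using \<phi>(2) sub that lists[of v] by (fastforce simp: respects_lists_def induced_def)+
  define A where "A c = {i. i < n \<and> vl ! i \<in> F \<and> \<phi> (vl ! i) = Suc c}" for c
  have indep: "\<not> adj i j" if "i \<in> A c" "j \<in> A c" for i j c
  proof
    assume "adj i j"
    then have "{vl ! i, vl ! j} \<in> edges (induced G F)"
      using that by (simp add: A_def adj_iff induced_def)
    then have "\<phi> (vl ! i) \<noteq> \<phi> (vl ! j)" using \<phi>(1) unfolding coloring_def by blast
    then show False using that by (simp add: A_def)
  qed
  have "\<exists>S\<in>set (p3_cover adj k [0..<n]). A c \<subseteq> set S" for c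
  proof (rule p3_cover_complete)
    show "\<not> has_p3s adj k (set [0..<n])" using no by (simp add: lessThan_atLeast0)
    show "A c \<subseteq> set [0..<n]" by (auto simp: A_def)
  qed (fact adj_sym adj_irrefl indep)+
  then obtain S where S: "\<And>c. S c \<in> set (p3_cover adj k [0..<n])" "\<And>c. A c \<subseteq> set (S c)" by metis
  let ?t = "map S [0..<r]"
  define X where "X = {(i, c). c < r \<and> i \<in> A c}"
  have t: "?t \<in> set (List.n_lists r (p3_cover adj k [0..<n]))"
    using S(1) by (auto simp: set_n_lists)
  have free: "\<forall>S\<in>set ?t. p3_free adj (set S)"
    using S(1) by (auto dest: cover_p3_free)
  interpret coloring_blocks adj "eligible M ?t" "[0..<r]" "block ?t" using coloring_blocks[OF free] .
  have XEl: "X \<subseteq> El"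
  proof
    fix e assume "e \<in> X"
    then obtain i c where e: "e = (i, c)" "c < r" "i \<in> A c" by (auto simp: X_def)
    then have i: "i < n" "vl ! i \<in> F" "\<phi> (vl ! i) = Suc c" by (auto simp: A_def)
    have "Suc c \<in> inst_lists I (vl ! i)" using lst(1)[OF i(2)] i(3) by simp
    with i show "e \<in> El" using e S(2)[of c] by (auto simp: El_iff[OF free] nth_default_def)
  qed
  have "finite X"
    by (rule finite_subset[of _ "{..<n} \<times> {..<r}"]) (auto simp: X_def A_def)
  moreover have injX: "inj_on fst X" by (auto simp: inj_on_def X_def A_def)
  moreover have "inj_on (block ?t) X"
  proof (rule inj_onI, rule ccontr)
    fix p q assume pq: "p \<in> X" "q \<in> X" "block ?t p = block ?t q" "p \<noteq> q"
    then have "fst p \<noteq> fst q" using injX by (auto simp: inj_on_def)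
    then have "conflict adj p q" using block[of p q] pq XEl by (auto simp: El_def)
    then show False using pq indep by (auto simp: conflict_def X_def)
  qed
  ultimately have "valid ?t X" using XEl by (simp add: valid_def matching_def)
  moreover have "(!) vl ` fst ` X = F"
  proof
    show "(!) vl ` fst ` X \<subseteq> F" by (auto simp: X_def A_def)
    show "F \<subseteq> (!) vl ` fst ` X"
    proof
      fix v assume v: "v \<in> F"
      then obtain i where i: "i < n" "vl ! i = v" using sub vl(1) by (metis in_set_conv_nth subsetD)
      then have "(i, \<phi> v - 1) \<in> X" using lst[OF v] v by (auto simp: X_def A_def)
      then show "v \<in> (!) vl ` fst ` X" using i(2) by force
    qed
  qed
  ultimately show ?thesis using that t by blast
qed

lemma solve_optimal:
  assumes no: "\<not> has_p3s adj k {..<n}"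
  defines "F \<equiv> (!) vl ` fst ` set (best_coloring r k M)"
  shows "mwlcis_solution I F" and "enc (solve r k M) = enc_vertex_set I F"
proof -
  let ?ts = "List.n_lists r (p3_cover adj k [0..<n])"
  let ?col = "\<lambda>t. max_weight_coloring adj (eligible M t) [0..<r] (lighter M) [0..<n]"
  have free: "\<forall>S\<in>set t. p3_free adj (set S)" if "t \<in> set ?ts" for t
    using that cover_p3_free unfolding set_n_lists by blast
  define \<Q> where "\<Q> t = {Q. valid t (set Q) \<and> distinct Q \<and> fst ` set Q \<subseteq> set [0..<n]}" for t
  have le: "lighter M Q R \<longleftrightarrow> sum \<omega> (fst ` set Q) \<le> sum \<omega> (fst ` set R)"
    if "Q \<in> \<Q> t" "R \<in> \<Q> t'" for Q R t t'
    by (rule lighter_iff) (use that in \<open>auto simp: \<Q>_def valid_def matching_def\<close>)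
  have col: "?col t \<in> \<Q> t" "valid t X \<Longrightarrow> sum \<omega> (fst ` X) \<le> sum \<omega> (fst ` set (?col t))"
    if t: "t \<in> set ?ts" for t X
  proof -
    interpret coloring_blocks adj "eligible M t" "[0..<r]" "block t"
      using coloring_blocks[OF free[OF t]] .
    have "?col t \<in> \<Q> t \<and> (\<forall>X. matching El (block t) X \<longrightarrow> fst ` X \<subseteq> set [0..<n] \<longrightarrow>
        sum \<omega> (fst ` X) \<le> sum \<omega> (fst ` set (?col t)))"
      by (rule max_weight_coloring_optimal) (use le in \<open>simp_all add: \<Q>_def valid_def\<close>)
    moreover have "fst ` X \<subseteq> set [0..<n]" if "valid t X"
      using that El_iff[OF free[OF t]] by (auto simp: valid_def matching_def El_def)
    ultimately show "?col t \<in> \<Q> t" "valid t X \<Longrightarrow> sum \<omega> (fst ` X) \<le> sum \<omega> (fst ` set (?col t))"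
      by (auto simp: valid_def)
  qed
  let ?P = "best_coloring r k M"
  let ?l = "map ?col ?ts"
  have P: "?P = best (lighter M) [] ?l" by (simp add: best_coloring_def length_M)
  have Nil: "[] \<in> \<Q> t" for t by (simp add: \<Q>_def valid_def matching_def)
  \<comment> \<open>The default \<open>[]\<close> of \<open>best\<close> is attributed to the empty
    tuple, for which \<open>P_3\<close>-freeness of the members is vacuous.\<close>
  have mem: "\<exists>t. (t \<in> set ?ts \<or> t = []) \<and> Q \<in> \<Q> t" if "Q \<in> insert [] (set ?l)" for Q
    using that col(1) Nil by auto
  have Pmem: "?P \<in> insert [] (set ?l)" unfolding P by (rule best_mem)
  then obtain t where t: "t \<in> set ?ts \<or> t = []" "?P \<in> \<Q> t" using mem by blast
  have "\<forall>S\<in>set t. p3_free adj (set S)" using t(1) free by auto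
  then have feas: "mwlcis_feasible I F"
    unfolding F_def using t(2) by (intro valid_feasible[of t]) (auto simp: \<Q>_def)
  have Psub: "fst ` set ?P \<subseteq> {..<n}" using t(2) by (auto simp: \<Q>_def)
  have "sum (inst_weight I) F' \<le> sum (inst_weight I) F" if F': "mwlcis_feasible I F'" for F'
  proof -
    obtain t X where tX: "t \<in> set ?ts" "valid t X" "(!) vl ` fst ` X = F'"
      using feasible_valid[OF F' no] by blast
    have "fst ` X \<subseteq> {..<n}"
      using tX(2) El_iff[OF free[OF tX(1)]] by (auto simp: valid_def matching_def)
    then have "sum (inst_weight I) F' = sum \<omega> (fst ` X)" using sum_colored tX(3) by blast
    also have "\<dots> \<le> sum \<omega> (fst ` set (?col t))" using col(2) tX by blast
    also have "\<dots> \<le> sum \<omega> (fst ` set ?P)"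
      unfolding P
    proof (rule best_ge[where w = "\<lambda>Q. sum \<omega> (fst ` set Q)"])
      show "?col t \<in> insert [] (set ?l)" using tX(1) by auto
      fix Q R assume "Q \<in> insert [] (set ?l)" "R \<in> insert [] (set ?l)"
      then obtain t t' where "Q \<in> \<Q> t" "R \<in> \<Q> t'" using mem by meson
      then show "lighter M Q R \<longleftrightarrow> sum \<omega> (fst ` set Q) \<le> sum \<omega> (fst ` set R)" by (rule le)
    qed
    also have "\<dots> = sum (inst_weight I) F" unfolding F_def using sum_colored Psub by simp
    finally show ?thesis .
  qed
  with feas show "mwlcis_solution I F" unfolding mwlcis_solution_def by blast
  have "solve r k M = map (\<lambda>v. v \<in> F) vl"
  proof (rule nth_equalityI)
    fix i assume "i < length (solve r k M)"
    then have i: "i < n" by (simp add: solve_def length_M Let_def)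
    have "(\<exists>p\<in>set ?P. fst p = i) \<longleftrightarrow> vl ! i \<in> F"
    proof
      assume "vl ! i \<in> F"
      then obtain p where "p \<in> set ?P" "vl ! i = vl ! fst p" by (auto simp: F_def)
      then show "\<exists>p\<in>set ?P. fst p = i" using vl_nth_eq[OF i] Psub by auto
    qed (auto simp: F_def)
    then show "solve r k M ! i = map (\<lambda>v. v \<in> F) vl ! i"
      using i by (simp add: solve_def length_M Let_def)
  qed (simp add: solve_def length_M Let_def)
  then show "enc (solve r k M) = enc_vertex_set I F"
    unfolding enc_vertex_set_def by (simp add: enc_list_map[of _ "\<lambda>v. v \<in> F"] enc_Bool)
qed

end


subsection \<open>Induced copies of \<open>kP\<^sub>3\<close>\<close>

text \<open>The peeled path becomes copy number \<open>k\<close>, with \<open>a\<close>,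
  \<open>b\<close>, \<open>c\<close> at positions 0, 1, 2; \<open>apart\<close> separates it from
  the copies given by the induction hypothesis.\<close>

lemma has_p3s_embedding:
  assumes sym: "\<And>a b. adj a b \<Longrightarrow> adj b a" and irrefl: "\<And>a. \<not> adj a a"
  shows "has_p3s adj k U \<Longrightarrow> \<exists>f :: nat \<times> nat \<Rightarrow> nat. inj_on f ({..<k} \<times> {..<3}) \<and>
    f ` ({..<k} \<times> {..<3}) \<subseteq> U \<and>
    (\<forall>p\<in>{..<k} \<times> {..<3}. \<forall>q\<in>{..<k} \<times> {..<3}. adj (f p) (f q) \<longleftrightarrow>
      fst p = fst q \<and> (snd q = Suc (snd p) \<or> snd p = Suc (snd q)))"
proof (induction k arbitrary: U)
  case 0
  then show ?case by simp
next
  case (Suc k)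
  let ?D = "{..<k} \<times> {..<3 :: nat}"
  from Suc.prems obtain a b c where abc: "a \<in> U" "b \<in> U" "c \<in> U" "a \<noteq> c" "adj a b" "adj b c" "\<not> adj a c"
    and rest: "has_p3s adj k {u \<in> U. apart adj a b c u}" by auto
  from Suc.IH[OF rest] obtain f where f: "inj_on f ?D" "f ` ?D \<subseteq> {u \<in> U. apart adj a b c u}"
    "\<forall>p\<in>?D. \<forall>q\<in>?D. adj (f p) (f q) \<longleftrightarrow> fst p = fst q \<and> (snd q = Suc (snd p) \<or> snd p = Suc (snd q))"
    by blast
  define g where "g j = (if j = 0 then a else if j = 1 then b else c)" for j :: nat
  define h where "h p = (if fst p < k then f p else g (snd p))" for p
  have three: "j = 0 \<or> j = 1 \<or> j = 2" if "j < 3" for j :: nat using that by auto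
  have g_abc: "g j \<in> {a, b, c}" for j by (simp add: g_def)
  have ne: "a \<noteq> b" "b \<noteq> c" using abc irrefl by auto
  have adjs: "adj b a" "adj c b" "\<not> adj c a" "\<not> adj a a" "\<not> adj b b" "\<not> adj c c"
    using abc sym irrefl by blast+
  have g_adj: "adj (g i) (g j) \<longleftrightarrow> j = Suc i \<or> i = Suc j" if "i < 3" "j < 3" for i j
    using three[OF that(1)] three[OF that(2)] abc adjs by (elim disjE) (simp_all add: g_def)
  have g_inj: "g i = g j \<longleftrightarrow> i = j" if "i < 3" "j < 3" for i j
    using three[OF that(1)] three[OF that(2)] abc ne by (elim disjE) (simp_all add: g_def)
  have apart: "f p \<noteq> x \<and> \<not> adj (f p) x \<and> \<not> adj x (f p)" if "p \<in> ?D" "x \<in> {a, b, c}" for p x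
  proof -
    have "apart adj a b c (f p)" using f(2) that(1) by blast
    then show ?thesis using that(2) sym unfolding apart_def by blast
  qed
  have split: "p \<in> ?D \<and> h p = f p \<or> fst p = k \<and> snd p < 3 \<and> h p = g (snd p)"
    if "p \<in> {..<Suc k} \<times> {..<3}" for p
    using that by (cases p) (auto simp: h_def less_Suc_eq)
  have mixed: "h p \<noteq> h q \<and> \<not> adj (h p) (h q) \<and> \<not> adj (h q) (h p) \<and> fst p \<noteq> fst q"
    if "p \<in> ?D \<and> h p = f p" "fst q = k \<and> snd q < 3 \<and> h q = g (snd q)" for p q
    using apart[of p "g (snd q)"] g_abc[of "snd q"] that by auto
  have inj: "p = q" if pq: "p \<in> {..<Suc k} \<times> {..<3}" "q \<in> {..<Suc k} \<times> {..<3}" "h p = h q" for p q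
    using split[OF pq(1)]
  proof
    assume p: "p \<in> ?D \<and> h p = f p"
    then have "q \<in> ?D \<and> h q = f q" using split[OF pq(2)] mixed[of p q] pq(3) by blast
    with p pq(3) show "p = q" using inj_onD[OF f(1), of p q] by simp
  next
    assume p: "fst p = k \<and> snd p < 3 \<and> h p = g (snd p)"
    then have "fst q = k \<and> snd q < 3 \<and> h q = g (snd q)"
      using split[OF pq(2)] mixed[of q p] pq(3) by metis
    with p pq(3) show "p = q" using g_inj[of "snd p" "snd q"] by (simp add: prod_eq_iff)
  qed
  have adj: "adj (h p) (h q) \<longleftrightarrow> fst p = fst q \<and> (snd q = Suc (snd p) \<or> snd p = Suc (snd q))"
    if pq: "p \<in> {..<Suc k} \<times> {..<3}" "q \<in> {..<Suc k} \<times> {..<3}" for p q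
    using split[OF pq(1)]
  proof
    assume p: "p \<in> ?D \<and> h p = f p"
    from split[OF pq(2)] show ?thesis
    proof
      assume q: "q \<in> ?D \<and> h q = f q"
      have "adj (f p) (f q) \<longleftrightarrow> fst p = fst q \<and> (snd q = Suc (snd p) \<or> snd p = Suc (snd q))"
        using p q by (intro f(3)[rule_format]) blast+
      with p q show ?thesis by metis
    qed (use mixed[OF p] in blast)
  next
    assume p: "fst p = k \<and> snd p < 3 \<and> h p = g (snd p)"
    from split[OF pq(2)] show ?thesis
    proof
      assume "q \<in> ?D \<and> h q = f q"
      from mixed[OF this p] show ?thesis by metis
    next
      assume "fst q = k \<and> snd q < 3 \<and> h q = g (snd q)"
      with p show ?thesis using g_adj[of "snd p" "snd q"] by simp
    qed
  qed
  have "h ` ({..<Suc k} \<times> {..<3}) \<subseteq> U"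
  proof
    fix x assume "x \<in> h ` ({..<Suc k} \<times> {..<3})"
    then obtain p where p: "p \<in> {..<Suc k} \<times> {..<3}" "x = h p" by blast
    have "f p \<in> U" if "p \<in> ?D" using f(2) that by blast
    moreover have "g (snd p) \<in> U" using g_abc[of "snd p"] abc(1-3) by auto
    ultimately show "x \<in> U" using split[OF p(1)] p(2) by auto
  qed
  moreover have "inj_on h ({..<Suc k} \<times> {..<3})" using inj by (rule inj_onI)
  ultimately show ?case using adj by (intro exI[of _ h]) blast
qed

lemma copies_path_3_edge:
  "{p, q} \<in> edges (copies k (path_graph 3)) \<longleftrightarrow>
    fst p < k \<and> fst p = fst q \<and> snd p < 3 \<and> snd q < 3 \<and> (snd q = Suc (snd p) \<or> snd p = Suc (snd q))"
  (is "?l \<longleftrightarrow> ?r")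
proof
  assume ?l
  then obtain i j where "i < k" "Suc j < 3" "{p, q} = Pair i ` {j, Suc j}"
    by (auto simp: copies_def path_graph_def)
  then have "{p, q} = {(i, j), (i, Suc j)}" by simp
  then show ?r using \<open>i < k\<close> \<open>Suc j < 3\<close> by (auto simp: doubleton_eq_iff)
next
  assume r: ?r
  have *: "{x, y} \<in> edges (copies k (path_graph 3))"
    if "fst x < k" "fst x = fst y" "snd y = Suc (snd x)" "snd y < 3" for x y
  proof -
    have "{x, y} = Pair (fst x) ` {snd x, Suc (snd x)}"
      using that by (cases x; cases y) auto
    moreover have "{snd x, Suc (snd x)} \<in> edges (path_graph 3)"
      using that by (auto simp: path_graph_def)
    ultimately show ?thesis using that(1) unfolding copies_def graph.simps by blast
  qed
  from r consider "snd q = Suc (snd p)" | "snd p = Suc (snd q)" by blast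
  then show ?l
  proof cases
    case 2
    have "{q, p} \<in> edges (copies k (path_graph 3))" using r 2 by (intro *) metis+
    moreover have "{p, q} = {q, p}" by blast
    ultimately show ?thesis by metis
  qed (use r in \<open>intro *; metis\<close>)
qed

lemma (in instance_rows) graph_free_imp:
  assumes free: "graph_free (copies k (path_graph 3)) G"
  shows "\<not> has_p3s adj k {..<n}"
proof
  let ?D = "{..<k} \<times> {..<3 :: nat}"
  assume "has_p3s adj k {..<n}"
  from has_p3s_embedding[OF adj_sym adj_irrefl this] obtain f where f: "inj_on f ?D"
    "f ` ?D \<subseteq> {..<n}" "\<forall>p\<in>?D. \<forall>q\<in>?D. adj (f p) (f q) \<longleftrightarrow>
      fst p = fst q \<and> (snd q = Suc (snd p) \<or> snd p = Suc (snd q))" by blast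
  let ?g = "\<lambda>p. vl ! f p" and ?H = "copies k (path_graph 3)"
  have D: "verts ?H = ?D" by (simp add: copies_def path_graph_def)
  have fn: "f p < n" if "p \<in> ?D" for p using f(2) that by auto
  have inj: "inj_on ?g ?D" using f(1) fn vl_nth_eq by (auto simp: inj_on_def)
  let ?S = "?g ` ?D"
  have S: "?S \<subseteq> verts G" using fn vl_nth_mem by auto
  have edge: "{?g p, ?g q} \<in> edges (induced G ?S) \<longleftrightarrow> {p, q} \<in> edges ?H"
    if pq: "p \<in> ?D" "q \<in> ?D" for p q
  proof -
    have "{?g p, ?g q} \<in> edges (induced G ?S) \<longleftrightarrow> adj (f p) (f q)"
      using pq fn by (simp add: induced_def adj_iff)
    then show ?thesis using f(3) pq unfolding copies_path_3_edge by auto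
  qed
  \<comment> \<open>\<open>graph_iso\<close> maps the induced subgraph to the pattern, so the
    embedding has to be inverted.\<close>
  let ?i = "the_inv_into ?D ?g"
  have verts: "verts (induced G ?S) = ?S" using S by (auto simp: induced_def)
  have "bij_betw ?i ?S ?D"
    using inj by (intro bij_betw_the_inv_into) (simp add: bij_betw_def)
  moreover have "{u, v} \<in> edges (induced G ?S) \<longleftrightarrow> {?i u, ?i v} \<in> edges ?H"
    if "u \<in> ?S" "v \<in> ?S" for u v
    using that edge the_inv_into_f_f[OF inj] by auto
  ultimately have "graph_iso (induced G ?S) ?H"
    unfolding graph_iso_def verts D by blast
  with S free show False unfolding graph_free_def by blast
qed

theorem theorem3:
  fixes r k :: nat
  assumes "r \<ge> 1"
  shows "solvable_in_polynomial_time
           {I. mwlcis_instance r I \<and> graph_free (copies k (path_graph 3)) (inst_graph I)}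
           (enc_mwlcis r) enc_vertex_set mwlcis_solution"
proof -
  obtain P e T where T: "pbounded T"
    and run: "\<And>M. \<exists>t\<le>T M. eval P [enc M] e (enc (solve r k M)) t"
    using ptime_solve[of r k] unfolding ptime_def by blast
  obtain p where p: "\<And>M. T M \<le> poly p (sz M)" using T unfolding pbounded_def by blast
  \<comment> \<open>Execution starts with function 0, which therefore has to be the main expression;
    all other functions move up by one.\<close>
  let ?P = "[shift_calls 1 e] @ map (shift_calls 1) P"
  show ?thesis
    unfolding solvable_in_polynomial_time_def
  proof (rule exI[of _ ?P], rule exI[of _ p], rule ballI)
    fix I assume "I \<in> {I. mwlcis_instance r I \<and> graph_free (copies k (path_graph 3)) (inst_graph I)}"
    then have I: "mwlcis_instance r I" and free: "graph_free (copies k (path_graph 3)) (inst_graph I)"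
      by auto
    interpret instance_rows r I by (standard) (rule I)
    obtain t where t: "t \<le> T (rows r I)" "eval P [enc (rows r I)] e (enc (solve r k (rows r I))) t"
      using run by blast
    from eval_link_right[OF t(2), of "[shift_calls 1 e]"]
    have "computes_in ?P (enc_mwlcis r I) (enc (solve r k (rows r I))) t"
      by (simp add: computes_in_def enc_rows)
    moreover have "t \<le> poly p (size (enc_mwlcis r I))"
      using t(1) p[of "rows r I"] by (simp add: enc_rows)
    ultimately show "\<exists>y t. mwlcis_solution I y \<and> computes_in ?P (enc_mwlcis r I) (enc_vertex_set I y) t \<and>
        t \<le> poly p (size (enc_mwlcis r I))"
      using solve_optimal[OF graph_free_imp[OF free]] by metis
  qed
qed

end
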